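(* Let $G$ be a locally compact second countable group and let $(Z,\mathfrak Z,\mu,S)$ be an IDPFT system. Then $S$ is amenable in the Greenleaf sense. Hence $S$ is amenable if and only if $G$ is amenable.
   Context: IDPFT system: for each $n\in\mathbb N$, $S_n=(S_n(g))_{g\in G}$ is an ergodic measure preserving $G$-action on a standard probability space $(Z_n,\mathfrak Z_n,\nu_n)$ and $\mu_n$ is a probability measure on $\mathfrak Z_n$ with $\mu_n\sim\nu_n$. Put $(Z,\mathfrak Z):=\bigotimes_n(Z_n,\mathfrak Z_n)$, $\mu:=\bigotimes_n\mu_n$, $S(g):=\bigotimes_nS_n(g)$. If $\mu\circ S(g)\sim\mu$ for each $g\in G$, then $(Z,\mathfrak Z,\mu,S)$ is called an infinite direct product of finite types (IDPFT). Let $\lambda_G$ be a left Haar measure on $G$. A nonsingular $G$-action $T$ on a standard probability space $(X,\mu)$ is amenable (in the sense of Zimmer) if there is a $G$-equivariant mean, i.e. positive unital linear map that is the identity on $L^\infty(X,\mu)$ (viewed as the functions on $X\times G$ not depending on the second variable), from $L^\infty(X\times G,\mu\otimes\lambda_G)$ onto $L^\infty(X,\mu)$, where $X\times G$ carries the diagonal $G$-action ($G$ acting on $G$ by left rotations). $T$ is amenable in the Greenleaf sense if there is a $G$-invariant mean on $L^\infty(X,\mu)$. *)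

theory Defs
  imports "HOL-Probability.Probability"
begin

text \<open>
  Topological groups are types of the library class
  \<^class>\<open>topological_group_add\<close>. That class is not assumed to be commutative: \<open>g + h\<close> is the
  group product, \<open>- g\<close> the inverse and \<open>0\<close> the identity element.
\<close>

definition standard_borel :: "'a measure \<Rightarrow> bool" where
  "standard_borel M \<longleftrightarrow>
     (\<exists>T. completely_metrizable_space T \<and> second_countable T \<and> topspace T = space M \<and>
          sets M = sigma_sets (space M) {U. openin T U})"

definition equivalent_measures :: "'a measure \<Rightarrow> 'a measure \<Rightarrow> bool" where
  "equivalent_measures M N \<longleftrightarrow>
     sets M = sets N \<and> absolutely_continuous M N \<and> absolutely_continuous N M"

definition left_haar_measure :: "'g::topological_group_add measure \<Rightarrow> bool" where
  "left_haar_measure haar \<longleftrightarrow>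
     sets haar = sets borel \<and> emeasure haar (space haar) \<noteq> 0 \<and>
     (\<forall>K. compact K \<longrightarrow> emeasure haar K < \<infinity>) \<and>
     (\<forall>g. distr haar haar (\<lambda>x. g + x) = haar)"

text \<open>For second countable locally compact Hausdorff groups, the regularity usually required of a
  Haar measure follows from finiteness on compact sets.\<close>

definition borel_action :: "'x measure \<Rightarrow> ('g::topological_group_add \<Rightarrow> 'x \<Rightarrow> 'x) \<Rightarrow> bool" where
  "borel_action M T \<longleftrightarrow>
     case_prod T \<in> borel \<Otimes>\<^sub>M M \<rightarrow>\<^sub>M M \<and>
     (\<forall>x\<in>space M. T 0 x = x) \<and>
     (\<forall>g h. \<forall>x\<in>space M. T (g + h) x = T g (T h x))"

definition measure_preserving_action ::
    "'x measure \<Rightarrow> ('g::topological_group_add \<Rightarrow> 'x \<Rightarrow> 'x) \<Rightarrow> bool" where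
  "measure_preserving_action M T \<longleftrightarrow> borel_action M T \<and> (\<forall>g. distr M M (T g) = M)"

definition ergodic_action ::
    "'x measure \<Rightarrow> ('g::topological_group_add \<Rightarrow> 'x \<Rightarrow> 'x) \<Rightarrow> bool" where
  "ergodic_action M T \<longleftrightarrow>
     (\<forall>A\<in>sets M. (\<forall>g. T g -` A \<inter> space M = A) \<longrightarrow> A \<in> null_sets M \<or> space M - A \<in> null_sets M)"

definition product_action :: "(nat \<Rightarrow> 'g \<Rightarrow> 'z \<Rightarrow> 'z) \<Rightarrow> 'g \<Rightarrow> (nat \<Rightarrow> 'z) \<Rightarrow> (nat \<Rightarrow> 'z)" where
  "product_action S g z = (\<lambda>n. S n g (z n))"

text \<open>
  The spaces \<open>Z\<^sub>n\<close> are the carriers \<open>space (\<nu> n)\<close>, which may differ from one \<open>n\<close> to the next.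
  The measure \<open>\<mu> \<circ> S(g)\<close>, that is \<open>A \<mapsto> \<mu>(S(g) A)\<close>, is the image of \<open>\<mu>\<close> under
  \<open>S(g)\<^sup>-\<^sup>1 = S(- g)\<close>.
\<close>

definition idpft ::
    "(nat \<Rightarrow> 'z measure) \<Rightarrow> (nat \<Rightarrow> 'z measure) \<Rightarrow>
     (nat \<Rightarrow> 'g::topological_group_add \<Rightarrow> 'z \<Rightarrow> 'z) \<Rightarrow> bool" where
  "idpft \<nu> \<mu> S \<longleftrightarrow>
     (\<forall>n. standard_borel (\<nu> n) \<and> prob_space (\<nu> n) \<and>
          measure_preserving_action (\<nu> n) (S n) \<and> ergodic_action (\<nu> n) (S n) \<and>
          prob_space (\<mu> n) \<and> equivalent_measures (\<mu> n) (\<nu> n)) \<and>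
     (\<forall>g. equivalent_measures
            (distr (PiM UNIV \<mu>) (PiM UNIV \<mu>) (product_action S (- g))) (PiM UNIV \<mu>))"

text \<open>
  Elements of \<open>L\<^sup>\<infinity>(M)\<close> are given by representatives: a map defined on \<open>L\<^sup>\<infinity>(M)\<close> is a map on
  essentially bounded measurable functions that respects almost everywhere equality.
\<close>

definition Linf :: "'a measure \<Rightarrow> ('a \<Rightarrow> real) set" where
  "Linf M = {f \<in> borel_measurable M. \<exists>C. AE x in M. \<bar>f x\<bar> \<le> C}"

definition mean_on_Linf :: "'a measure \<Rightarrow> (('a \<Rightarrow> real) \<Rightarrow> real) \<Rightarrow> bool" where
  "mean_on_Linf M m \<longleftrightarrow>
     (\<forall>f\<in>Linf M. \<forall>f'\<in>Linf M. (AE x in M. f x = f' x) \<longrightarrow> m f = m f') \<and>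
     (\<forall>f\<in>Linf M. \<forall>f'\<in>Linf M. m (\<lambda>x. f x + f' x) = m f + m f') \<and>
     (\<forall>f\<in>Linf M. \<forall>c. m (\<lambda>x. c * f x) = c * m f) \<and>
     (\<forall>f\<in>Linf M. (AE x in M. 0 \<le> f x) \<longrightarrow> 0 \<le> m f) \<and>
     m (\<lambda>_. 1) = 1"

definition greenleaf_amenable :: "'x measure \<Rightarrow> ('g \<Rightarrow> 'x \<Rightarrow> 'x) \<Rightarrow> bool" where
  "greenleaf_amenable M T \<longleftrightarrow>
     (\<exists>m. mean_on_Linf M m \<and> (\<forall>g. \<forall>f\<in>Linf M. m (\<lambda>x. f (T g x)) = m f))"

text \<open>A group is amenable if \<open>L\<^sup>\<infinity>(G, haar)\<close> carries a mean invariant under left translations.\<close>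

definition amenable_group :: "'g::topological_group_add measure \<Rightarrow> bool" where
  "amenable_group haar \<longleftrightarrow>
     (\<exists>m. mean_on_Linf haar m \<and> (\<forall>g. \<forall>f\<in>Linf haar. m (\<lambda>x. f (g + x)) = m f))"

definition positive_unital_linear_map ::
    "'a measure \<Rightarrow> 'b measure \<Rightarrow> (('a \<Rightarrow> real) \<Rightarrow> ('b \<Rightarrow> real)) \<Rightarrow> bool" where
  "positive_unital_linear_map M N P \<longleftrightarrow>
     (\<forall>F\<in>Linf M. P F \<in> Linf N) \<and>
     (\<forall>F\<in>Linf M. \<forall>F'\<in>Linf M. (AE x in M. F x = F' x) \<longrightarrow> (AE y in N. P F y = P F' y)) \<and>
     (\<forall>F\<in>Linf M. \<forall>F'\<in>Linf M. AE y in N. P (\<lambda>x. F x + F' x) y = P F y + P F' y) \<and>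
     (\<forall>F\<in>Linf M. \<forall>c. AE y in N. P (\<lambda>x. c * F x) y = c * P F y) \<and>
     (\<forall>F\<in>Linf M. (AE x in M. 0 \<le> F x) \<longrightarrow> (AE y in N. 0 \<le> P F y)) \<and>
     (AE y in N. P (\<lambda>_. 1) y = 1)"

text \<open>
  Amenability in the sense of Zimmer. The second condition says that \<open>P\<close> is the identity on
  \<open>L\<^sup>\<infinity>(M)\<close>, viewed inside \<open>L\<^sup>\<infinity>(M \<otimes> haar)\<close>; in particular \<open>P\<close> is onto. The last one is
  equivariance for the diagonal action \<open>(x, h) \<mapsto> (T g x, g + h)\<close>.
\<close>

definition zimmer_amenable ::
    "'g::topological_group_add measure \<Rightarrow> 'x measure \<Rightarrow> ('g \<Rightarrow> 'x \<Rightarrow> 'x) \<Rightarrow> bool" where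
  "zimmer_amenable haar M T \<longleftrightarrow>
     (\<exists>P. positive_unital_linear_map (M \<Otimes>\<^sub>M haar) M P \<and>
          (\<forall>f\<in>Linf M. AE x in M. P (\<lambda>(x, h). f x) x = f x) \<and>
          (\<forall>g. \<forall>F\<in>Linf (M \<Otimes>\<^sub>M haar).
             AE x in M. P (\<lambda>(x, h). F (T g x, g + h)) x = P F (T g x)))"

end

theory Submission
  imports Defs
begin

text \<open>
  Put \<open>\<kappa>\<^sub>n = \<nu>\<^sub>0 \<otimes> \<dots> \<otimes> \<nu>\<^sub>n\<^sub>-\<^sub>1 \<otimes> \<mu>\<^sub>n \<otimes> \<mu>\<^sub>n\<^sub>+\<^sub>1 \<otimes> \<dots>\<close>, which is absolutely continuous with respect to \<open>\<mu>\<close>.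
  Integrating the first \<open>n\<close> coordinates out of a bounded \<open>f\<close> with respect to \<open>\<nu>\<close> gives a function
  \<open>F\<^sub>n\<close> of the coordinates from \<open>n\<close> on, and since \<open>S(g)\<close> preserves each \<open>\<nu>\<^sub>k\<close>, the defect of invariance
  \<open>\<kappa>\<^sub>n(f \<circ> S(g)) - \<kappa>\<^sub>n(f)\<close> is \<open>\<integral>F\<^sub>n (h - 1) d\<mu>\<close>, where \<open>h\<close> is the density of the image of \<open>\<mu>\<close> under \<open>S(g)\<close>. Approximating
  \<open>h\<close> in \<open>L\<^sup>1\<close> by functions of finitely many coordinates, which are independent of \<open>F\<^sub>n\<close> for large \<open>n\<close>, one
  sees that it tends to \<open>0\<close>. An ultrafilter limit of the \<open>\<kappa>\<^sub>n\<close> is then an invariant mean.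

  Composing an invariant mean on \<open>L\<^sup>\<infinity>(\<mu>)\<close> with an equivariant conditional mean gives an invariant mean on
  \<open>L\<^sup>\<infinity>(G)\<close>. Conversely an invariant mean \<open>m\<close> on \<open>L\<^sup>\<infinity>(G)\<close> yields an equivariant conditional mean \<open>P\<close> by duality:
  \<open>\<integral>P F p d\<mu> = m(h \<mapsto> \<integral>F(x, h) p(x) d\<mu>(x))\<close> for \<open>p \<in> L\<^sup>1(\<mu>)\<close>.
\<close>

section \<open>Ultrafilter limits of means\<close>

text \<open>Finer filters are smaller, so an ultrafilter is a minimal proper filter and Zorn's lemma
  is applied to the reversed order. The infimum of a nonempty chain of proper filters is proper
  because the chain is a filter base: \<open>False\<close> would already hold eventually in one of
  its members.\<close>

lemma exists_ultrafilter_le: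
  assumes "F \<noteq> bot"
  obtains U :: "'a filter" where "U \<le> F" "U \<noteq> bot" "\<And>G. G \<le> U \<Longrightarrow> G \<noteq> bot \<Longrightarrow> G = U"
proof -
  let ?A = "{G. G \<le> F \<and> G \<noteq> bot}"
  have "\<exists>m\<in>?A. \<forall>a\<in>?A. a \<le> m \<longrightarrow> a = m"
  proof (rule predicate_Zorn)
    show "partial_order_on ?A (relation_of (\<lambda>a b. b \<le> a) ?A)"
      by (rule partial_order_on_relation_ofI) auto
    fix C assume C: "C \<in> Chains (relation_of (\<lambda>a b. b \<le> a) ?A)"
    then have sub: "C \<subseteq> ?A" and lin: "\<And>a b. a \<in> C \<Longrightarrow> b \<in> C \<Longrightarrow> a \<le> b \<or> b \<le> a"
      by (auto simp: Chains_def relation_of_def)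
    show "\<exists>u\<in>?A. \<forall>a\<in>C. u \<le> a"
    proof (cases "C = {}")
      case True then show ?thesis using assms by auto
    next
      case False
      have "Inf C \<noteq> bot"
        unfolding trivial_limit_def
      proof (subst eventually_Inf_base[OF False])
        fix a b assume "a \<in> C" "b \<in> C"
        then show "\<exists>x\<in>C. x \<le> inf a b" using lin[of a b] by (auto simp: inf_absorb1 inf_absorb2)
      next
        show "\<not> (\<exists>b\<in>C. eventually (\<lambda>x. False) b)" using sub by (auto simp: trivial_limit_def)
      qed
      moreover have "Inf C \<le> F" using False sub by (metis (no_types, lifting) Inf_lower2 all_not_in_conv mem_Collect_eq subset_eq)
      ultimately show ?thesis by (auto intro!: bexI[of _ "Inf C"] Inf_lower)
    qed
  qed
  then show ?thesis by (auto intro: that)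
qed

text \<open>Along an ultrafilter a bounded sequence has a cluster point by compactness of
  \<open>{-C..C}\<close>, and minimality of the filter makes a cluster point a limit.
  \<open>Lim U\<close> thus serves as a generalized limit of bounded sequences;
  \<open>U \<le> sequentially\<close> ensures that it extends the usual limit.\<close>

lemma exists_filter_Bseq_convergent:
  obtains U :: "nat filter" where "U \<le> sequentially" "U \<noteq> bot"
    "\<And>a :: nat \<Rightarrow> real. Bseq a \<Longrightarrow> (a \<longlongrightarrow> Lim U a) U"
proof -
  obtain U :: "nat filter" where U: "U \<le> sequentially" "U \<noteq> bot"
    and max: "\<And>G. G \<le> U \<Longrightarrow> G \<noteq> bot \<Longrightarrow> G = U"
    using exists_ultrafilter_le[of "sequentially :: nat filter"] by auto
  have "(a \<longlongrightarrow> Lim U a) U" if a: "Bseq a" for a :: "nat \<Rightarrow> real"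
  proof -
    obtain C where C: "\<And>n. norm (a n) \<le> C" using a by (auto simp: Bseq_def)
    have "filtermap a U \<noteq> bot" using U by (simp add: filtermap_bot_iff)
    moreover have "eventually (\<lambda>x. x \<in> {-C..C}) (filtermap a U)"
      unfolding eventually_filtermap
      by (rule always_eventually) (use C in \<open>simp add: abs_le_iff minus_le_iff\<close>)
    ultimately obtain x where x: "inf (nhds x) (filtermap a U) \<noteq> bot"
      using compact_filter[of "{-C..C}"] compact_Icc[of "-C" C] by auto
    \<comment> \<open>\<open>?G\<close> refines \<open>U\<close> by the demand that \<open>a\<close>
      be near \<open>x\<close>. It is proper since \<open>x\<close> is a cluster point, so
      minimality gives \<open>?G = U\<close>, which is convergence.\<close>
    let ?G = "inf U (filtercomap a (nhds x))"
    have "?G \<noteq> bot"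
    proof
      assume "?G = bot"
      then obtain P Q where "eventually P U" and Q: "eventually Q (nhds x)" and PQ: "\<And>n. P n \<Longrightarrow> \<not> Q (a n)"
        unfolding trivial_limit_def eventually_inf eventually_filtercomap by metis
      then have "eventually (\<lambda>y. \<not> Q y) (filtermap a U)"
        by (auto simp: eventually_filtermap elim: eventually_mono)
      with Q x show False
        unfolding trivial_limit_def eventually_inf by metis
    qed
    then have "?G = U" by (intro max) auto
    then have "U \<le> filtercomap a (nhds x)" by (metis inf.cobounded2)
    then have "(a \<longlongrightarrow> x) U" by (simp add: filterlim_iff_le_filtercomap)
    then show ?thesis using U tendsto_Lim by blast
  qed
  with U that show ?thesis by blast
qed

section \<open>Essentially bounded functions under absolutely continuous changes of measure\<close>

lemma Linf_comp:
  assumes f: "f \<in> Linf M" and T: "T \<in> M \<rightarrow>\<^sub>M M" and ac: "absolutely_continuous M (distr M M T)"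
  shows "(\<lambda>x. f (T x)) \<in> Linf M"
proof -
  obtain C where fm: "f \<in> borel_measurable M" and C: "AE x in M. \<bar>f x\<bar> \<le> C" using f by (auto simp: Linf_def)
  have "AE x in distr M M T. \<bar>f x\<bar> \<le> C"
    using absolutely_continuous_AE[OF _ ac C] by simp
  from AE_distrD[OF T this] show ?thesis
    using fm T by (auto simp: Linf_def)
qed

lemma Linf_integrable:
  assumes "finite_measure K" "sets K = sets M" "absolutely_continuous M K" "f \<in> Linf M"
  shows "integrable K f"
proof -
  interpret finite_measure K by fact
  obtain C where [measurable]: "f \<in> borel_measurable M" and C: "AE x in M. \<bar>f x\<bar> \<le> C"
    using assms by (auto simp: Linf_def)
  have "AE x in K. norm (f x) \<le> C" using absolutely_continuous_AE[OF assms(2,3) C] by simp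
  moreover have "f \<in> borel_measurable K" by (simp add: measurable_cong_sets[OF assms(2) refl])
  ultimately show ?thesis by (rule integrable_const_bound)
qed

lemma abs_integral_le_AE_bound:
  fixes f :: "'a \<Rightarrow> real"
  assumes "prob_space K" "AE x in K. \<bar>f x\<bar> \<le> C"
  shows "\<bar>integral\<^sup>L K f\<bar> \<le> C"
proof -
  interpret prob_space K by fact
  show ?thesis
  proof (cases "integrable K f")
    case True
    have "integral\<^sup>L K f \<le> C" using assms(2) True by (intro integral_le_const) auto
    moreover have "-C \<le> integral\<^sup>L K f" using assms(2) True by (intro integral_ge_const) auto
    ultimately show ?thesis by simp
  next
    case False
    \<comment> \<open>Without integrability the integral is 0 by convention, so only
      \<open>0 \<le> C\<close> is left; it holds because the whole of a probability space is not
      null.\<close>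
    have "0 \<le> C"
    proof (rule ccontr)
      assume "\<not> 0 \<le> C"
      have "AE x in K. False" using assms(2) by eventually_elim (use \<open>\<not> 0 \<le> C\<close> in linarith)
      then show False by simp
    qed
    then show ?thesis by (simp add: not_integrable_integral_eq[OF False])
  qed
qed

text \<open>Each \<open>K n\<close> integrates to a mean on \<open>Linf M\<close> because it does
  not charge the null sets of \<open>M\<close>. Linearity, positivity and the unit survive the limit
  along \<open>U\<close>, and the defect of invariance, which vanishes along
  \<open>sequentially\<close>, vanishes along the finer \<open>U\<close>.\<close>

lemma greenleaf_amenable_asymptotic:
  fixes K :: "nat \<Rightarrow> 'x measure"
  assumes K: "\<And>n. prob_space (K n)" "\<And>n. sets (K n) = sets M" "\<And>n. absolutely_continuous M (K n)"
    and T: "\<And>g. T g \<in> M \<rightarrow>\<^sub>M M" "\<And>g. absolutely_continuous M (distr M M (T g))"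
    and inv: "\<And>g f. f \<in> Linf M \<Longrightarrow>
      (\<lambda>n. integral\<^sup>L (K n) (\<lambda>x. f (T g x)) - integral\<^sup>L (K n) f) \<longlonglongrightarrow> 0"
  shows "greenleaf_amenable M T"
proof -
  obtain U :: "nat filter" where U: "U \<le> sequentially" "U \<noteq> bot"
    and lim: "\<And>a :: nat \<Rightarrow> real. Bseq a \<Longrightarrow> (a \<longlongrightarrow> Lim U a) U"
    using exists_filter_Bseq_convergent by blast
  define m where "m f = Lim U (\<lambda>n. integral\<^sup>L (K n) f)" for f :: "'x \<Rightarrow> real"
  note AE_K = absolutely_continuous_AE[OF K(2,3)]
  have int: "integrable (K n) f" if "f \<in> Linf M" for n f
    by (rule Linf_integrable[OF prob_space.finite_measure[OF K(1)] K(2,3) that])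
  have m: "((\<lambda>n. integral\<^sup>L (K n) f) \<longlongrightarrow> m f) U" if f: "f \<in> Linf M" for f
  proof -
    obtain C where C: "AE x in M. \<bar>f x\<bar> \<le> C" using f by (auto simp: Linf_def)
    have "norm (integral\<^sup>L (K n) f) \<le> C" for n
      using abs_integral_le_AE_bound[OF K(1) AE_K[OF C]] by simp
    then show ?thesis unfolding m_def by (intro lim BseqI')
  qed
  note m_eq = tendsto_unique[OF U(2) m]
  have add: "m (\<lambda>x. f x + f' x) = m f + m f'" if "f \<in> Linf M" "f' \<in> Linf M" for f f'
  proof -
    have eq: "integral\<^sup>L (K n) (\<lambda>x. f x + f' x) = integral\<^sup>L (K n) f + integral\<^sup>L (K n) f'" for n
      by (rule Bochner_Integration.integral_add[OF int[OF that(1)] int[OF that(2)]])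
    show ?thesis
      unfolding m_def[of "\<lambda>x. f x + f' x"] eq
      by (rule tendsto_Lim[OF U(2) tendsto_add[OF m[OF that(1)] m[OF that(2)]]])
  qed
  have "mean_on_Linf M m"
    unfolding mean_on_Linf_def
  proof (intro conjI ballI impI allI)
    fix f f' assume f: "f \<in> Linf M" "f' \<in> Linf M" "AE x in M. f x = f' x"
    have "integral\<^sup>L (K n) f = integral\<^sup>L (K n) f'" for n
      using AE_K[OF f(3), of n] int f by (intro integral_cong_AE) auto
    then show "m f = m f'" by (simp add: m_def)
  next
    fix f c assume f: "f \<in> Linf M"
    show "m (\<lambda>x. c * f x) = c * m f"
      unfolding m_def[of "\<lambda>x. c * f x"] integral_mult_right_zero
      by (rule tendsto_Lim[OF U(2) tendsto_mult_left[OF m[OF f]]])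
  next
    fix f assume f: "f \<in> Linf M" "AE x in M. 0 \<le> f x"
    show "0 \<le> m f"
      by (rule tendsto_lowerbound[OF m[OF f(1)] always_eventually U(2)])
        (auto intro!: integral_nonneg_AE AE_K[OF f(2)])
  next
    have "integral\<^sup>L (K n) (\<lambda>_. 1) = (1::real)" for n
      using prob_space.prob_space[OF K(1)] by simp
    then show "m (\<lambda>_. 1) = 1" using U(2) by (simp add: m_def tendsto_Lim)
  qed (auto intro: add)
  moreover have "m (\<lambda>x. f (T g x)) = m f" if f: "f \<in> Linf M" for g f
  proof -
    have fT: "(\<lambda>x. f (T g x)) \<in> Linf M" by (rule Linf_comp[OF f T])
    have "((\<lambda>n. integral\<^sup>L (K n) (\<lambda>x. f (T g x)) - integral\<^sup>L (K n) f) \<longlongrightarrow> 0) U"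
      using filterlim_mono[OF inv[OF f] order_refl U(1)] .
    then have "m (\<lambda>x. f (T g x)) - m f = 0"
      using tendsto_unique[OF U(2) tendsto_diff[OF m[OF fT] m[OF f]]] by blast
    then show ?thesis by simp
  qed
  ultimately show ?thesis unfolding greenleaf_amenable_def by blast
qed

section \<open>Infinite product measures\<close>

text \<open>Both arguments are total families, so that products over \<open>UNIV\<close> suffice
  throughout. Applied to independent \<open>u\<close> and \<open>w\<close>, it resamples the
  coordinates in \<open>I\<close> and keeps the others.\<close>

definition fun_splice :: "'i set \<Rightarrow> ('i \<Rightarrow> 'a) \<Rightarrow> ('i \<Rightarrow> 'a) \<Rightarrow> 'i \<Rightarrow> 'a" where
  "fun_splice I u w = (\<lambda>k. if k \<in> I then u k else w k)"

lemma measurable_fun_splice: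
  assumes "\<And>k. k \<in> I \<Longrightarrow> sets (A k) = sets (M k)" "\<And>k. k \<notin> I \<Longrightarrow> sets (B k) = sets (M k)"
  shows "(\<lambda>(u, w). fun_splice I u w) \<in> PiM UNIV A \<Otimes>\<^sub>M PiM UNIV B \<rightarrow>\<^sub>M PiM UNIV M"
  unfolding fun_splice_def split_def
proof (rule measurable_PiM_single')
  fix k
  let ?P = "PiM UNIV A \<Otimes>\<^sub>M PiM UNIV B"
  have "(\<lambda>x. fst x k) \<in> ?P \<rightarrow>\<^sub>M M k" if "k \<in> I"
    by (subst measurable_cong_sets[OF refl assms(1)[OF that, symmetric]]) measurable
  moreover have "(\<lambda>x. snd x k) \<in> ?P \<rightarrow>\<^sub>M M k" if "k \<notin> I"
    by (subst measurable_cong_sets[OF refl assms(2)[OF that, symmetric]]) measurable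
  ultimately show "(\<lambda>x. if k \<in> I then fst x k else snd x k) \<in> ?P \<rightarrow>\<^sub>M M k"
    by (cases "k \<in> I") simp_all
next
  have "k \<in> I \<Longrightarrow> x \<in> space (A k) \<Longrightarrow> x \<in> space (M k)"
    "k \<notin> I \<Longrightarrow> x \<in> space (B k) \<Longrightarrow> x \<in> space (M k)" for k x
    using sets_eq_imp_space_eq[OF assms(1)] sets_eq_imp_space_eq[OF assms(2)] by auto
  then show "(\<lambda>x k. if k \<in> I then fst x k else snd x k)
      \<in> space (PiM UNIV A \<Otimes>\<^sub>M PiM UNIV B) \<rightarrow> (\<Pi>\<^sub>E k\<in>UNIV. space (M k))"
    by (auto simp: space_pair_measure space_PiM PiE_iff split: if_splits)
qed

text \<open>The preimage of a cylinder over \<open>J\<close> is the rectangle of a cylinder over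
  \<open>J \<inter> I\<close> and one over \<open>J - I\<close>, so both measures agree on
  cylinders, which determine finite measures on the product.\<close>

lemma distr_fun_splice:
  assumes A: "\<And>k. prob_space (A k)" and B: "\<And>k. prob_space (B k)"
    and sA: "\<And>k. sets (A k) = sets (M k)" and sB: "\<And>k. sets (B k) = sets (M k)"
  shows "distr (PiM UNIV A \<Otimes>\<^sub>M PiM UNIV B) (PiM UNIV M) (\<lambda>(u, w). fun_splice I u w) =
    PiM UNIV (\<lambda>k. if k \<in> I then A k else B k)" (is "?L = PiM UNIV ?R")
proof (rule measure_eqI_PiM_infinite)
  have m: "(\<lambda>(u, w). fun_splice I u w) \<in> PiM UNIV A \<Otimes>\<^sub>M PiM UNIV B \<rightarrow>\<^sub>M PiM UNIV M"
    by (rule measurable_fun_splice[OF sA sB])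
  have R: "prob_space (?R k)" for k using A B by simp
  have spA: "space (A k) = space (M k)" and spB: "space (B k) = space (M k)" for k
    by (rule sets_eq_imp_space_eq[OF sA], rule sets_eq_imp_space_eq[OF sB])
  interpret PA: prob_space "PiM UNIV A" using A by (rule prob_space_PiM)
  interpret PB: prob_space "PiM UNIV B" using B by (rule prob_space_PiM)
  interpret pair_prob_space "PiM UNIV A" "PiM UNIV B" ..
  show "sets ?L = sets (PiM UNIV M)" by simp
  show "sets (PiM UNIV ?R) = sets (PiM UNIV M)" using sA sB by (intro sets_PiM_cong) auto
  show "finite_measure ?L" by (intro prob_space.finite_measure prob_space_distr m)
  fix X and J :: "'a set" assume J: "finite J" "J \<subseteq> UNIV" and X: "\<And>i. i \<in> J \<Longrightarrow> X i \<in> sets (M i)"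
  have XM: "X i \<subseteq> space (M i)" if "i \<in> J" for i using X[OF that] sets.sets_into_space by blast
  let ?E = "\<lambda>M J. prod_emb UNIV M J (Pi\<^sub>E J X)"
  have "emeasure ?L (?E M J) =
      emeasure (PiM UNIV A \<Otimes>\<^sub>M PiM UNIV B) ((\<lambda>(u, w). fun_splice I u w) -` ?E M J \<inter> space (PiM UNIV A \<Otimes>\<^sub>M PiM UNIV B))"
    using J X by (intro emeasure_distr m sets_PiM_I) auto
  also have "(\<lambda>(u, w). fun_splice I u w) -` ?E M J \<inter> space (PiM UNIV A \<Otimes>\<^sub>M PiM UNIV B) = ?E A (J \<inter> I) \<times> ?E B (J - I)"
    by (auto simp: prod_emb_def space_pair_measure space_PiM fun_splice_def PiE_iff spA spB split: if_splits)
  also have "emeasure (PiM UNIV A \<Otimes>\<^sub>M PiM UNIV B) \<dots> = emeasure (PiM UNIV A) (?E A (J \<inter> I)) * emeasure (PiM UNIV B) (?E B (J - I))"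
    using J X by (intro PB.emeasure_pair_measure_Times sets_PiM_I) (auto simp: sA sB)
  also have "\<dots> = (\<Prod>i\<in>J \<inter> I. emeasure (A i) (X i)) * (\<Prod>i\<in>J - I. emeasure (B i) (X i))"
    using J X by (subst (1 2) emeasure_PiM_emb) (auto simp: A B sA sB)
  also have "\<dots> = (\<Prod>i\<in>J. emeasure (?R i) (X i))"
    using J prod.Int_Diff[of J "\<lambda>i. emeasure (?R i) (X i)" I] by simp
  also have "\<dots> = emeasure (PiM UNIV ?R) (?E ?R J)"
    using J X by (intro emeasure_PiM_emb[symmetric] R) (auto simp: sA sB)
  also have "?E ?R J = ?E M J" using spA spB by (auto simp: prod_emb_def space_PiM split: if_splits)
  finally show "emeasure ?L (?E M J) = emeasure (PiM UNIV ?R) (?E M J)" .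
qed

lemma measurable_PiM_componentwise:
  assumes "\<And>k. T k \<in> A k \<rightarrow>\<^sub>M M k"
  shows "(\<lambda>z k. T k (z k)) \<in> PiM UNIV A \<rightarrow>\<^sub>M PiM UNIV M"
proof (rule measurable_PiM_single')
  show "(\<lambda>z. T k (z k)) \<in> PiM UNIV A \<rightarrow>\<^sub>M M k" for k
    by (rule measurable_compose[where f = "\<lambda>z. z k" and g = "T k", OF _ assms]) simp
  show "(\<lambda>z k. T k (z k)) \<in> space (PiM UNIV A) \<rightarrow> (\<Pi>\<^sub>E k\<in>UNIV. space (M k))"
    using measurable_space[OF assms] by (auto simp: space_PiM PiE_iff)
qed

text \<open>The preimage of a cylinder is the cylinder of the coordinate preimages. It serves to
  show that a coordinatewise action preserves the product of its invariant measures.\<close>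

lemma distr_PiM_componentwise:
  assumes A: "\<And>k. prob_space (A k)" and T: "\<And>k. T k \<in> A k \<rightarrow>\<^sub>M M k"
  shows "distr (PiM UNIV A) (PiM UNIV M) (\<lambda>z k. T k (z k)) = PiM UNIV (\<lambda>k. distr (A k) (M k) (T k))"
    (is "?L = PiM UNIV ?R")
proof (rule measure_eqI_PiM_infinite)
  note m = measurable_PiM_componentwise[OF T]
  have R: "prob_space (?R k)" for k using A T by (intro prob_space.prob_space_distr)
  interpret PA: prob_space "PiM UNIV A" using A by (rule prob_space_PiM)
  show "sets ?L = sets (PiM UNIV M)" by simp
  show "sets (PiM UNIV ?R) = sets (PiM UNIV M)" by (intro sets_PiM_cong) auto
  show "finite_measure ?L" by (intro prob_space.finite_measure PA.prob_space_distr m)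
  fix X and J :: "'a set" assume J: "finite J" "J \<subseteq> UNIV" and X: "\<And>i. i \<in> J \<Longrightarrow> X i \<in> sets (M i)"
  let ?E = "\<lambda>M. prod_emb UNIV M J (Pi\<^sub>E J X)"
  have "emeasure ?L (?E M) = emeasure (PiM UNIV A) ((\<lambda>z k. T k (z k)) -` ?E M \<inter> space (PiM UNIV A))"
    using J X by (intro emeasure_distr m sets_PiM_I) auto
  also have "(\<lambda>z k. T k (z k)) -` ?E M \<inter> space (PiM UNIV A) =
      prod_emb UNIV A J (\<Pi>\<^sub>E i\<in>J. T i -` X i \<inter> space (A i))"
    using measurable_space[OF T] by (auto simp: prod_emb_def space_PiM PiE_iff)
  also have "emeasure (PiM UNIV A) \<dots> = (\<Prod>i\<in>J. emeasure (A i) (T i -` X i \<inter> space (A i)))"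
    using J X by (intro emeasure_PiM_emb A measurable_sets[OF T]) auto
  also have "\<dots> = (\<Prod>i\<in>J. emeasure (?R i) (X i))"
    using X by (intro prod.cong refl emeasure_distr[symmetric] T) auto
  also have "\<dots> = emeasure (PiM UNIV ?R) (?E ?R)"
    using J X by (intro emeasure_PiM_emb[symmetric] R) auto
  also have "?E ?R = ?E M" by (auto simp: prod_emb_def)
  finally show "emeasure ?L (?E M) = emeasure (PiM UNIV ?R) (?E M)" .
qed

text \<open>Separates coordinate \<open>i\<close> as the first factor of a binary product, so that a
  change of measure there can be studied with Fubini.\<close>

lemma PiM_fun_upd:
  assumes "\<And>k. prob_space (M k)" "prob_space N"
  shows "PiM UNIV (M(i := N)) =
    distr (N \<Otimes>\<^sub>M PiM (UNIV - {i}) M) (PiM UNIV (M(i := N))) (\<lambda>(x, w). w(i := x))"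
proof -
  have "prob_space ((M(i := N)) k)" for k using assms by simp
  then have "distr ((M(i := N)) i \<Otimes>\<^sub>M PiM (UNIV - {i}) (M(i := N))) (PiM (insert i (UNIV - {i})) (M(i := N)))
      (\<lambda>(x, w). w(i := x)) = PiM (insert i (UNIV - {i})) (M(i := N))"
    by (intro distr_pair_PiM_eq_PiM[of "UNIV - {i}" "M(i := N)" i]) assumption+
  moreover have "PiM (UNIV - {i}) (M(i := N)) = PiM (UNIV - {i}) M" by (intro PiM_cong) auto
  ultimately show ?thesis by (simp add: insert_absorb)
qed

text \<open>By Fubini, almost every slice of a null set in direction \<open>i\<close> is null for
  \<open>M i\<close>, hence for \<open>N\<close>; Fubini in reverse makes the set null for the new
  product.\<close>

lemma absolutely_continuous_PiM_fun_upd: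
  assumes M: "\<And>k. prob_space (M k)" and N: "prob_space N" "sets N = sets (M i)" "absolutely_continuous (M i) N"
  shows "absolutely_continuous (PiM UNIV M) (PiM UNIV (M(i := N)))"
proof -
  let ?R = "PiM (UNIV - {i}) M" and ?u = "\<lambda>(x, w). w(i := x)"
  interpret R: prob_space ?R using M by (intro prob_space_PiM)
  interpret N: prob_space N by fact
  interpret Mi: prob_space "M i" by (rule M)
  interpret NR: pair_prob_space N ?R ..
  interpret MR: pair_prob_space "M i" ?R ..
  have s: "sets (PiM UNIV (M(i := N))) = sets (PiM UNIV M)"
    using N by (intro sets_PiM_cong) auto
  have MM: "PiM UNIV M = distr (M i \<Otimes>\<^sub>M ?R) (PiM UNIV M) ?u"
    using PiM_fun_upd[where M = M and N = "M i" and i = i, OF M M] by simp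
  have NN: "PiM UNIV (M(i := N)) = distr (N \<Otimes>\<^sub>M ?R) (PiM UNIV M) ?u"
    by (rule trans[OF PiM_fun_upd[OF M N(1)] distr_cong]) (simp_all only: s)
  have "(\<lambda>(w, x). w(i := x)) \<in> (?R \<Otimes>\<^sub>M M i) \<rightarrow>\<^sub>M PiM (insert i (UNIV - {i})) M"
    by (rule measurable_add_dim)
  then have u0: "(\<lambda>(w, x). w(i := x)) \<in> (?R \<Otimes>\<^sub>M M i) \<rightarrow>\<^sub>M PiM UNIV M"
    by (simp add: insert_absorb)
  have u: "?u \<in> (M i \<Otimes>\<^sub>M ?R) \<rightarrow>\<^sub>M PiM UNIV M"
    using measurable_compose[OF measurable_pair_swap' u0] by (simp add: split_def)
  have uN: "?u \<in> (N \<Otimes>\<^sub>M ?R) \<rightarrow>\<^sub>M PiM UNIV M"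
    using u by (simp add: measurable_cong_sets[OF sets_pair_measure_cong[OF N(2) refl]])
  show ?thesis
    unfolding absolutely_continuous_def
  proof
    fix X assume X: "X \<in> null_sets (PiM UNIV M)"
    then have Xs[measurable]: "X \<in> sets (PiM UNIV M)" by auto
    have "AE z in PiM UNIV M. z \<notin> X" by (rule AE_not_in[OF X])
    then have "AE z in distr (M i \<Otimes>\<^sub>M ?R) (PiM UNIV M) ?u. z \<notin> X" by (simp only: MM[symmetric])
    then have "AE p in M i \<Otimes>\<^sub>M ?R. ?u p \<notin> X" by (rule AE_distrD[OF u])
    \<comment> \<open>The variable \<open>w\<close> of the unchanged factor is put outside, so that
      the inner quantifier alone carries the passage from \<open>M i\<close> to
      \<open>N\<close>.\<close>
    then have "AE w in ?R. AE x in M i. w(i := x) \<notin> X"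
      using u0 by (subst MR.AE_commute[symmetric]) (auto dest!: MR.AE_pair)
    then have "AE w in ?R. AE x in N. w(i := x) \<notin> X"
      by eventually_elim (rule absolutely_continuous_AE[OF N(2,3)])
    then have "AE x in N. AE w in ?R. w(i := x) \<notin> X"
      using u0 uN by (subst NR.AE_commute) auto
    moreover have "{p \<in> space (N \<Otimes>\<^sub>M ?R). ?u p \<notin> X} =
        space (N \<Otimes>\<^sub>M ?R) - (?u -` X \<inter> space (N \<Otimes>\<^sub>M ?R))" by auto
    then have "{p \<in> space (N \<Otimes>\<^sub>M ?R). ?u p \<notin> X} \<in> sets (N \<Otimes>\<^sub>M ?R)"
      using sets.compl_sets[OF measurable_sets[OF uN Xs]] by simp
    ultimately have "AE p in N \<Otimes>\<^sub>M ?R. ?u p \<notin> X"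
      by (intro NR.AE_pair_measure) (simp_all only: prod.case)
    then have "AE z in PiM UNIV (M(i := N)). z \<notin> X"
      unfolding NN by (subst AE_distr_iff[OF uN]) auto
    then show "X \<in> null_sets (PiM UNIV (M(i := N)))"
      using s Xs by (simp add: AE_iff_null_sets)
  qed
qed

section \<open>Functions of the tail coordinates\<close>

text \<open>The hypotheses are those of the limit case of \<open>integrable_induct\<close>;
  dominated convergence with bound \<open>3 * \<bar>f x\<bar>\<close> turns them into convergence in
  mean.\<close>

lemma (in prob_space) integrable_L1_limit:
  fixes f :: "'a \<Rightarrow> real"
  assumes lim: "\<And>x. x \<in> space M \<Longrightarrow> (\<lambda>i. s i x) \<longlonglongrightarrow> f x"
    and bd: "\<And>i x. x \<in> space M \<Longrightarrow> \<bar>s i x\<bar> \<le> 2 * \<bar>f x\<bar>"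
    and [measurable]: "integrable M f" "\<And>i. s i \<in> borel_measurable M"
  shows "(\<lambda>i. \<integral>x. \<bar>f x - s i x\<bar> \<partial>M) \<longlonglongrightarrow> 0"
proof -
  have "(\<lambda>i. \<integral>x. \<bar>f x - s i x\<bar> \<partial>M) \<longlonglongrightarrow> (\<integral>x. 0 \<partial>M)"
  proof (rule integral_dominated_convergence[where w = "\<lambda>x. 3 * \<bar>f x\<bar>"])
    show "AE x in M. (\<lambda>i. \<bar>f x - s i x\<bar>) \<longlonglongrightarrow> 0"
    proof (rule AE_I2)
      fix x assume "x \<in> space M"
      then have "(\<lambda>i. \<bar>f x - s i x\<bar>) \<longlonglongrightarrow> \<bar>f x - f x\<bar>" by (intro tendsto_intros lim)
      then show "(\<lambda>i. \<bar>f x - s i x\<bar>) \<longlonglongrightarrow> 0" by simp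
    qed
    show "AE x in M. norm \<bar>f x - s i x\<bar> \<le> 3 * \<bar>f x\<bar>" for i
    proof (rule AE_I2)
      fix x assume "x \<in> space M"
      from bd[OF this, of i] show "norm \<bar>f x - s i x\<bar> \<le> 3 * \<bar>f x\<bar>"
        unfolding real_norm_def by linarith
    qed
  qed (use assms in auto)
  then show ?thesis by simp
qed

lemma (in prob_space) integrable_bounded_mult:
  fixes h :: "'a \<Rightarrow> real"
  assumes [measurable]: "integrable M h" "G \<in> borel_measurable M" and "\<And>w. w \<in> space M \<Longrightarrow> \<bar>G w\<bar> \<le> C"
  shows "integrable M (\<lambda>w. G w * h w)" "\<bar>\<integral>w. G w * h w \<partial>M\<bar> \<le> C * (\<integral>w. \<bar>h w\<bar> \<partial>M)"
proof -
  have bd: "\<bar>G w * h w\<bar> \<le> C * \<bar>h w\<bar>" if "w \<in> space M" for w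
    using assms(3)[OF that] by (simp add: abs_mult mult_right_mono)
  have iC: "integrable M (\<lambda>w. C * \<bar>h w\<bar>)" using assms(1) by auto
  show int: "integrable M (\<lambda>w. G w * h w)"
    by (rule Bochner_Integration.integrable_bound[OF iC])
      (use bd in \<open>auto intro!: AE_I2 order_trans[OF bd]\<close>)
  have "\<bar>\<integral>w. G w * h w \<partial>M\<bar> \<le> (\<integral>w. \<bar>G w * h w\<bar> \<partial>M)" by (rule integral_abs_bound)
  also have "\<dots> \<le> (\<integral>w. C * \<bar>h w\<bar> \<partial>M)"
    using int iC bd by (intro integral_mono) auto
  finally show "\<bar>\<integral>w. G w * h w \<partial>M\<bar> \<le> C * (\<integral>w. \<bar>h w\<bar> \<partial>M)" by simp
qed

text \<open>Fubini for \<open>distr_fun_splice\<close>. The inner integral removes the coordinates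
  in \<open>I\<close> and leaves a function of the coordinates of \<open>w\<close> outside
  \<open>I\<close>.\<close>

lemma integral_fun_splice:
  fixes f :: "('i \<Rightarrow> 'a) \<Rightarrow> real"
  assumes A: "\<And>k. prob_space (A k)" and B: "\<And>k. prob_space (B k)"
    and sA: "\<And>k. sets (A k) = sets (M k)" and sB: "\<And>k. sets (B k) = sets (M k)"
    and f: "f \<in> borel_measurable (PiM UNIV M)" and bd: "\<And>x. x \<in> space (PiM UNIV M) \<Longrightarrow> \<bar>f x\<bar> \<le> C"
  shows "integral\<^sup>L (PiM UNIV (\<lambda>k. if k \<in> I then A k else B k)) f =
      (\<integral>w. (\<integral>u. f (fun_splice I u w) \<partial>PiM UNIV A) \<partial>PiM UNIV B)"
    and "(\<lambda>w. \<integral>u. f (fun_splice I u w) \<partial>PiM UNIV A) \<in> borel_measurable (PiM UNIV B)"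
proof -
  interpret PA: prob_space "PiM UNIV A" using A by (rule prob_space_PiM)
  interpret PB: prob_space "PiM UNIV B" using B by (rule prob_space_PiM)
  interpret pair_prob_space "PiM UNIV A" "PiM UNIV B" ..
  have m: "(\<lambda>(u, w). fun_splice I u w) \<in> PiM UNIV A \<Otimes>\<^sub>M PiM UNIV B \<rightarrow>\<^sub>M PiM UNIV M"
    by (rule measurable_fun_splice[OF sA sB])
  let ?f = "\<lambda>(u, w). f (fun_splice I u w)"
  have fm: "?f \<in> borel_measurable (PiM UNIV A \<Otimes>\<^sub>M PiM UNIV B)"
    using measurable_compose[OF m f] by (simp add: split_def)
  have int: "integrable (PiM UNIV A \<Otimes>\<^sub>M PiM UNIV B) ?f"
  proof (rule P.integrable_const_bound[of _ C])
    show "AE x in PiM UNIV A \<Otimes>\<^sub>M PiM UNIV B. norm (?f x) \<le> C"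
      using measurable_space[OF m] bd by (intro AE_I2) (auto simp: split_def)
  qed (rule fm)
  have "integral\<^sup>L (PiM UNIV (\<lambda>k. if k \<in> I then A k else B k)) f =
      integral\<^sup>L (PiM UNIV A \<Otimes>\<^sub>M PiM UNIV B) ?f"
    using integral_distr[OF m f] unfolding distr_fun_splice[OF A B sA sB] by (simp add: split_def)
  also have "\<dots> = (\<integral>w. (\<integral>u. f (fun_splice I u w) \<partial>PiM UNIV A) \<partial>PiM UNIV B)"
    using integral_snd[OF int] by simp
  finally show "integral\<^sup>L (PiM UNIV (\<lambda>k. if k \<in> I then A k else B k)) f = \<dots>" .
  have "(\<lambda>(w, u). f (fun_splice I u w)) \<in> borel_measurable (PiM UNIV B \<Otimes>\<^sub>M PiM UNIV A)"
    using measurable_compose[OF measurable_pair_swap' fm] by (simp add: split_def)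
  then show "(\<lambda>w. \<integral>u. f (fun_splice I u w) \<partial>PiM UNIV A) \<in> borel_measurable (PiM UNIV B)"
    by (rule PA.borel_measurable_lebesgue_integral)
qed

text \<open>The \<open>h\<close> that satisfy the conclusion form a linear space, closed under
  \<open>L^1\<close> limits by the uniform bound \<open>C\<close>. It contains the indicators of
  cylinders, since such an indicator is independent of \<open>G n\<close> for large \<open>n\<close>
  and \<open>G n\<close> is centred.\<close>

lemma tail_functions_decorrelate:
  fixes M :: "nat \<Rightarrow> 'a measure" and G :: "nat \<Rightarrow> (nat \<Rightarrow> 'a) \<Rightarrow> real"
  assumes M: "\<And>k. prob_space (M k)"
    and G[measurable]: "\<And>n. G n \<in> borel_measurable (PiM UNIV M)"
    and bd: "\<And>n w. w \<in> space (PiM UNIV M) \<Longrightarrow> \<bar>G n w\<bar> \<le> C"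
    and tail: "\<And>n v w. (\<And>k. n \<le> k \<Longrightarrow> v k = w k) \<Longrightarrow> G n v = G n w"
    and mean: "\<And>n. integral\<^sup>L (PiM UNIV M) (G n) = 0"
    and h: "integrable (PiM UNIV M) h"
  shows "(\<lambda>n. \<integral>w. G n w * h w \<partial>PiM UNIV M) \<longlonglongrightarrow> 0"
proof -
  define P where "P = PiM UNIV M"
  interpret P: prob_space P unfolding P_def using M by (rule prob_space_PiM)
  note [measurable] = G[folded P_def]
  note bd = bd[folded P_def]
  note mean = mean[folded P_def]
  define Q where "Q h \<longleftrightarrow> (\<lambda>n. \<integral>w. G n w * h w \<partial>P) \<longlonglongrightarrow> 0" for h
  note intG = P.integrable_bounded_mult(1)[OF _ G[folded P_def] bd]
  have add: "Q (\<lambda>x. f x + f' x)" if "integrable P f" "integrable P f'" "Q f" "Q f'" for f f'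
  proof -
    have "(\<integral>w. G n w * (f w + f' w) \<partial>P) = (\<integral>w. G n w * f w \<partial>P) + (\<integral>w. G n w * f' w \<partial>P)" for n
      unfolding distrib_left using that intG by (intro Bochner_Integration.integral_add) auto
    then show ?thesis using tendsto_add[OF that(3,4)[unfolded Q_def]] by (simp add: Q_def)
  qed
  have scale: "Q (\<lambda>x. c * f x)" if "Q f" for c f
    using tendsto_mult_left[OF that[unfolded Q_def], of c] by (simp add: Q_def mult.left_commute)
  have lim: "Q f" if s: "\<And>i. integrable P (s i)" "\<And>i. Q (s i)" "integrable P f"
    "\<And>x. x \<in> space P \<Longrightarrow> (\<lambda>i. s i x) \<longlonglongrightarrow> f x" "\<And>i x. x \<in> space P \<Longrightarrow> \<bar>s i x\<bar> \<le> 2 * \<bar>f x\<bar>" for f s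
    unfolding Q_def
  proof (rule LIMSEQ_I)
    fix r :: real assume r: "0 < r"
    have "(\<lambda>i. C * (\<integral>x. \<bar>f x - s i x\<bar> \<partial>P)) \<longlonglongrightarrow> C * 0"
      using s by (intro tendsto_mult_left P.integrable_L1_limit) auto
    from LIMSEQ_D[OF this, of "r / 2"] r
    obtain i where "\<forall>k\<ge>i. norm (C * (\<integral>x. \<bar>f x - s k x\<bar> \<partial>P) - C * 0) < r / 2" by auto
    then have i: "\<bar>C * (\<integral>x. \<bar>f x - s i x\<bar> \<partial>P)\<bar> < r / 2" by (metis diff_zero mult_zero_right order_refl real_norm_def)
    from LIMSEQ_D[OF s(2)[of i, unfolded Q_def], of "r / 2"] r
    obtain n0 where n0: "\<And>n. n \<ge> n0 \<Longrightarrow> \<bar>\<integral>w. G n w * s i w \<partial>P\<bar> < r / 2" by auto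
    have "\<bar>\<integral>w. G n w * f w \<partial>P\<bar> < r" if "n \<ge> n0" for n
    proof -
      have d: "integrable P (\<lambda>w. f w - s i w)"
        using \<open>integrable P f\<close> \<open>\<And>i. integrable P (s i)\<close> by auto
      have "(\<integral>w. G n w * (f w - s i w) \<partial>P) = (\<integral>w. G n w * f w \<partial>P) - (\<integral>w. G n w * s i w \<partial>P)"
        unfolding right_diff_distrib using intG \<open>integrable P f\<close> \<open>\<And>i. integrable P (s i)\<close>
        by (intro Bochner_Integration.integral_diff) auto
      \<comment> \<open>This bound on the error is uniform in \<open>n\<close>; hence
        \<open>i\<close> can be fixed before \<open>n0\<close> is chosen.\<close>
      moreover have "\<bar>\<integral>w. G n w * (f w - s i w) \<partial>P\<bar> \<le> C * (\<integral>x. \<bar>f x - s i x\<bar> \<partial>P)"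
        by (rule P.integrable_bounded_mult(2)[OF d]) (auto intro: bd)
      ultimately show ?thesis using i n0[OF that] by linarith
    qed
    then show "\<exists>no. \<forall>n\<ge>no. norm ((\<integral>w. G n w * f w \<partial>P) - 0) < r" by auto
  qed
  have cylinder: "Q (indicator A)" if A: "A \<in> prod_algebra UNIV M" for A
  proof -
    from A obtain J X where J: "A = prod_emb UNIV M J (Pi\<^sub>E J X)" "finite J"
      and X: "\<And>i. i \<in> J \<Longrightarrow> X i \<in> sets (M i)"
      by (auto elim!: prod_algebraE)
    have As[measurable]: "A \<in> sets (PiM UNIV M)" unfolding J(1) by (rule sets_PiM_I) (use J(2) X in auto)
    from J(2) obtain N where "J \<subseteq> {..<N}" unfolding finite_nat_iff_bounded by auto
    then have N: "\<And>j. j \<in> J \<Longrightarrow> j < N" by auto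
    have "(\<integral>w. G n w * indicator A w \<partial>P) = 0" if "n \<ge> N" for n
    proof -
      \<comment> \<open>With \<open>u\<close> in the first \<open>n\<close> coordinates and
        \<open>w\<close> in the rest, \<open>G n\<close> sees only \<open>w\<close> and, as
        \<open>N \<le> n\<close>, the cylinder sees only \<open>u\<close>. The integral over
        independent \<open>u\<close> and \<open>w\<close> therefore factors, and the factor of
        \<open>G n\<close> is 0.\<close>
      have sp: "G n (fun_splice {..<n} u w) * indicator A (fun_splice {..<n} u w) = G n w * indicator A u"
        if "u \<in> space P" "w \<in> space P" for u w
      proof -
        have "G n (fun_splice {..<n} u w) = G n w" by (rule tail) (simp add: fun_splice_def)
        moreover have "fun_splice {..<n} u w \<in> A \<longleftrightarrow> u \<in> A"
        proof -
          have "fun_splice {..<n} u w j = u j" if "j \<in> J" for j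
            using N[OF that] \<open>n \<ge> N\<close> by (simp add: fun_splice_def)
          then show ?thesis
            unfolding J using that by (auto simp: prod_emb_def P_def space_PiM PiE_iff fun_splice_def)
        qed
        ultimately show ?thesis by (simp add: indicator_def)
      qed
      have "\<bar>G n w * indicator A w\<bar> \<le> C" if "w \<in> space P" for w
        using bd[OF that, of n] by (auto simp: indicator_def)
      then have "(\<integral>w. G n w * indicator A w \<partial>P) =
          (\<integral>w. (\<integral>u. G n (fun_splice {..<n} u w) * indicator A (fun_splice {..<n} u w) \<partial>P) \<partial>P)"
        using integral_fun_splice(1)[where f = "\<lambda>w. G n w * indicator A w" and C = C and I = "{..<n}",
            OF M M refl refl]
        by (simp add: P_def)
      also have "\<dots> = (\<integral>w. (\<integral>u. G n w * indicator A u \<partial>P) \<partial>P)"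
        by (intro Bochner_Integration.integral_cong refl sp)
      also have "\<dots> = 0" by (simp add: mean)
      finally show ?thesis .
    qed
    then show ?thesis unfolding Q_def
      by (intro tendsto_eventually) (auto simp: eventually_sequentially)
  qed
  have int_ind: "integrable P (indicator A :: _ \<Rightarrow> real)" if "A \<in> sets P" for A
    using that by (intro integrable_real_indicator) (auto simp: P.emeasure_eq_measure)
  \<comment> \<open>Cylinders are closed under intersection, so Dynkin's argument applies.
    Complements use that \<open>G n\<close> has integral 0; countable disjoint unions are limits of
    finite sums.\<close>
  have indicator: "Q (indicator A)" if A: "A \<in> sets P" for A
    using Int_stable_prod_algebra prod_algebra_sets_into_space A[unfolded P_def sets_PiM]
  proof (induction rule: sigma_sets_induct_disjoint)
    case (basic A) then show ?case by (rule cylinder)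
  next
    case empty show ?case by (simp add: Q_def)
  next
    case (compl A)
    then have A: "A \<in> sets P" by (simp add: P_def sets_PiM)
    have "(\<integral>w. G n w * indicator (space P - A) w \<partial>P) = - (\<integral>w. G n w * indicator A w \<partial>P)" for n
    proof -
      have "(\<integral>w. G n w * indicator (space P - A) w \<partial>P) = (\<integral>w. G n w * 1 - G n w * indicator A w \<partial>P)"
        by (intro Bochner_Integration.integral_cong) (auto simp: indicator_def)
      also have "\<dots> = (\<integral>w. G n w * 1 \<partial>P) - (\<integral>w. G n w * indicator A w \<partial>P)"
        using A int_ind by (intro Bochner_Integration.integral_diff intG) auto
      finally show ?thesis by (simp add: mean)
    qed
    then have "Q (indicator (space P - A))" using tendsto_minus[OF compl(2)[unfolded Q_def]] by (simp add: Q_def)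
    then show ?case by (simp add: P_def space_PiM)
  next
    case (union A)
    then have A: "\<And>i. A i \<in> sets P" by (auto simp: P_def sets_PiM)
    have fin: "Q (\<lambda>x. \<Sum>j<i. indicator (A j) x)" for i :: nat
    proof (induction i)
      case 0 show ?case by (simp add: Q_def)
    next
      case (Suc i)
      have "Q (\<lambda>x. (\<Sum>j<i. indicator (A j) x) + indicator (A i) x)"
        using A union(3) Suc by (intro add) (auto intro!: int_ind Bochner_Integration.integrable_sum)
      then show ?case by simp
    qed
    have eq: "(\<Sum>j<i. indicator (A j) x) = (indicator (\<Union>j<i. A j) x :: real)" for i x
      using union(1) by (intro indicator_UN_disjoint[symmetric]) (auto simp: disjoint_family_on_def)
    show ?case
    proof (rule lim[of "\<lambda>i x. indicator (\<Union>j<i. A j) x"])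
      show "integrable P (indicator (\<Union>j<i. A j) :: _ \<Rightarrow> real)" for i
        using A by (intro int_ind) auto
      show "integrable P (indicator (\<Union>i. A i) :: _ \<Rightarrow> real)"
        using A by (intro int_ind) auto
      show "Q (\<lambda>x. indicator (\<Union>j<i. A j) x)" for i using fin[of i] by (simp only: eq)
      show "(\<lambda>i. indicator (\<Union>j<i. A j) x :: real) \<longlonglongrightarrow> indicator (\<Union>i. A i) x" for x
        by (rule LIMSEQ_indicator_UN)
      show "\<bar>indicator (\<Union>j<i. A j) x :: real\<bar> \<le> 2 * \<bar>indicator (\<Union>i. A i) x\<bar>" for i x
        by (auto simp: indicator_def)
    qed
  qed
  note Q_add = add and Q_lim = lim
  have "Q h" using h[folded P_def]
  proof (induction rule: integrable_induct)
    case (base A c)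
    then show ?case using scale[OF indicator, of A c] by (simp add: mult.commute)
  next
    case (add f g) then show ?case by (intro Q_add)
  next
    case (lim f s) then show ?case by (intro Q_lim[of s f]) auto
  qed
  then show ?thesis by (simp add: Q_def P_def)
qed

section \<open>Invariant means for product actions\<close>

text \<open>Radon-Nikodym with a real density that is nonnegative everywhere, the form in which
  Bochner integrals over \<open>density M h\<close> unfold.\<close>

lemma (in finite_measure) real_density_exists:
  assumes N: "finite_measure N" "sets N = sets M" "absolutely_continuous M N"
  obtains h :: "'a \<Rightarrow> real" where "h \<in> borel_measurable M" "integrable M h" "\<And>x. 0 \<le> h x"
    "N = density M h"
proof -
  obtain D where D: "D \<in> borel_measurable M" "AE x in M. RN_deriv M N x = ennreal (D x)"
      "\<And>x. 0 \<le> D x"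
    using real_RN_deriv[OF N(1,3,2)] by metis
  have N_eq: "N = density M D"
    using density_RN_deriv[OF N(3,2)] density_cong[OF _ _ D(2)] D(1) by simp
  interpret N: finite_measure N by fact
  have "integrable M D"
    using N.emeasure_finite[of "space M"] D(1,3) unfolding N_eq
    by (intro integrableI_nonneg) (auto simp: emeasure_density less_top cong: nn_integral_cong_simp)
  with D N_eq show ?thesis by (intro that)
qed

lemma absolutely_continuous_trans:
  "absolutely_continuous L M \<Longrightarrow> absolutely_continuous M N \<Longrightarrow> absolutely_continuous L N"
  unfolding absolutely_continuous_def by blast

text \<open>The measures are exchanged one coordinate at a time. The restriction to finitely many
  coordinates is essential: the two full products may be mutually singular.\<close>

lemma absolutely_continuous_PiM_initial_segment:
  fixes A M :: "nat \<Rightarrow> 'a measure"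
  assumes M: "\<And>k. prob_space (M k)" and A: "\<And>k. prob_space (A k)"
    and s: "\<And>k. sets (A k) = sets (M k)" and ac: "\<And>k. absolutely_continuous (M k) (A k)"
  shows "absolutely_continuous (PiM UNIV M) (PiM UNIV (\<lambda>k. if k \<in> {..<n} then A k else M k))"
proof (induction n)
  case 0 show ?case by (simp add: absolutely_continuous_def)
next
  case (Suc n)
  let ?R = "\<lambda>n k. if k \<in> {..<n} then A k else M k"
  have "absolutely_continuous (PiM UNIV (?R n)) (PiM UNIV ((?R n)(n := A n)))"
    using M A s ac by (intro absolutely_continuous_PiM_fun_upd) auto
  moreover have "(?R n)(n := A n) = ?R (Suc n)" by (auto simp: less_Suc_eq)
  ultimately show ?case using absolutely_continuous_trans[OF Suc] by simp
qed

lemma fun_splice_product_action: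
  "fun_splice I (product_action S g u) (product_action S g w) = product_action S g (fun_splice I u w)"
  by (auto simp: fun_splice_def product_action_def)

text \<open>In the application \<open>M\<close> is the family \<mu> and \<open>A\<close> the family
  \<nu>. In the proof \<open>K n\<close> is the measure \<open>\<kappa>\<^sub>n\<close>, which
  replaces \<mu> by \<nu> below \<open>n\<close>.\<close>

lemma greenleaf_amenable_product_action:
  fixes A M :: "nat \<Rightarrow> 'a measure" and S :: "nat \<Rightarrow> 'g \<Rightarrow> 'a \<Rightarrow> 'a"
  assumes M: "\<And>k. prob_space (M k)" and A: "\<And>k. prob_space (A k)"
    and s: "\<And>k. sets (A k) = sets (M k)" and ac: "\<And>k. absolutely_continuous (M k) (A k)"
    and S: "\<And>k g. S k g \<in> A k \<rightarrow>\<^sub>M A k" "\<And>k g. distr (A k) (A k) (S k g) = A k"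
    and ns: "\<And>g. absolutely_continuous (PiM UNIV M) (distr (PiM UNIV M) (PiM UNIV M) (product_action S g))"
  shows "greenleaf_amenable (PiM UNIV M) (product_action S)"
proof -
  define P where "P = PiM UNIV M"
  define N where "N = PiM UNIV A"
  define K where "K n = PiM UNIV (\<lambda>k. if k \<in> {..<n} then A k else M k)" for n :: nat
  interpret P: prob_space P unfolding P_def using M by (rule prob_space_PiM)
  interpret N: prob_space N unfolding N_def using A by (rule prob_space_PiM)
  have sN: "sets N = sets P" unfolding N_def P_def using s by (intro sets_PiM_cong) auto
  have action_eq: "product_action S g = (\<lambda>z k. S k g (z k))" for g by (auto simp: product_action_def)
  have Tm: "product_action S g \<in> P \<rightarrow>\<^sub>M P" "product_action S g \<in> N \<rightarrow>\<^sub>M N" for g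
  proof -
    have "S k g \<in> M k \<rightarrow>\<^sub>M M k" for k using S(1) measurable_cong_sets[OF s s] by blast
    then show "product_action S g \<in> P \<rightarrow>\<^sub>M P"
      unfolding P_def action_eq by (rule measurable_PiM_componentwise)
    show "product_action S g \<in> N \<rightarrow>\<^sub>M N"
      unfolding N_def action_eq by (rule measurable_PiM_componentwise[OF S(1)])
  qed
  have TN: "distr N N (product_action S g) = N" for g
    using distr_PiM_componentwise[where A = A and M = A and T = "\<lambda>k. S k g", OF A S(1)]
    by (simp add: S(2) N_def action_eq)
  have sK: "sets (K n) = sets P" for n unfolding K_def P_def using s by (intro sets_PiM_cong) auto
  have pK: "prob_space (K n)" for n unfolding K_def using A M by (intro prob_space_PiM) auto
  have acK: "absolutely_continuous P (K n)" for n
    unfolding P_def K_def by (rule absolutely_continuous_PiM_initial_segment[OF M A s ac])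
  note ns = ns[folded P_def]
  show ?thesis unfolding P_def[symmetric]
  proof (rule greenleaf_amenable_asymptotic[OF pK sK acK Tm(1) ns])
    fix g f assume f: "f \<in> Linf P"
    define T where "T = product_action S g"
    note T = Tm(1)[of g, folded T_def]
    obtain C where fm[measurable]: "f \<in> borel_measurable P" and "AE x in P. \<bar>f x\<bar> \<le> C"
      using f by (auto simp: Linf_def)
    \<comment> \<open>\<open>f0\<close> is a representative of \<open>f\<close> bounded at every
      point, since Fubini over splices and the estimate of \<open>F n\<close> ask for pointwise
      bounds. \<open>\<bar>C\<bar>\<close> keeps the clamping interval nonempty whatever the sign of
      \<open>C\<close>.\<close>
    define f0 where "f0 x = max (- \<bar>C\<bar>) (min \<bar>C\<bar> (f x))" for x
    have f0m: "f0 \<in> borel_measurable P" unfolding f0_def by measurable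
    have f0C: "\<bar>f0 x\<bar> \<le> \<bar>C\<bar>" for x by (auto simp: f0_def)
    have ff0: "AE x in P. f x = f0 x" using \<open>AE x in P. \<bar>f x\<bar> \<le> C\<close>
      by eventually_elim (auto simp: f0_def)
    have "AE x in P. f (T x) = f0 (T x)"
      by (rule AE_distrD[OF T absolutely_continuous_AE[OF sets_distr ns[of g, folded T_def] ff0]])
    note AE_K = absolutely_continuous_AE[OF sK acK]
    define F where "F n w = (\<integral>u. f0 (fun_splice {..<n} u w) \<partial>N)" for n w
    have Fm: "F n \<in> borel_measurable P" for n
      using integral_fun_splice(2)[where f = f0 and C = "\<bar>C\<bar>" and I = "{..<n}", OF A M s refl] f0m f0C
      by (simp add: F_def[abs_def] P_def N_def)
    have Kf: "integral\<^sup>L (K n) f1 = (\<integral>w. (\<integral>u. f1 (fun_splice {..<n} u w) \<partial>N) \<partial>P)"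
      if "f1 \<in> borel_measurable P" "\<And>x. \<bar>f1 x\<bar> \<le> \<bar>C\<bar>" for f1 n
      using integral_fun_splice(1)[where f = f1 and C = "\<bar>C\<bar>" and I = "{..<n}", OF A M s refl] that
      by (simp add: P_def N_def K_def)
    have FC: "\<bar>F n w\<bar> \<le> \<bar>C\<bar>" for n w
      unfolding F_def by (rule abs_integral_le_AE_bound) (use f0C N.prob_space_axioms in auto)
    have Ftail: "F n v = F n w" if "\<And>k. n \<le> k \<Longrightarrow> v k = w k" for n v w
    proof -
      have "fun_splice {..<n} u v = fun_splice {..<n} u w" for u using that by (auto simp: fun_splice_def)
      then show ?thesis by (simp add: F_def)
    qed
    have K1: "integral\<^sup>L (K n) f = integral\<^sup>L P (F n)" for n
    proof -
      have "integral\<^sup>L (K n) f = integral\<^sup>L (K n) f0"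
        using fm f0m AE_K[OF ff0] sK by (intro integral_cong_AE) (simp_all cong: measurable_cong_sets)
      also have "\<dots> = integral\<^sup>L P (F n)" using Kf[OF f0m f0C] by (simp add: F_def[abs_def])
      finally show ?thesis .
    qed
    \<comment> \<open>Since \<open>T\<close> acts coordinatewise it commutes with
      \<open>fun_splice\<close>, and since it preserves \<open>N\<close> the variable
      \<open>u\<close> absorbs it. Only \<open>w\<close> remains moved, so \<open>F n\<close> is
      integrated against the image of \<open>P\<close>.\<close>
    have K2: "integral\<^sup>L (K n) (\<lambda>x. f (T x)) = integral\<^sup>L (distr P P T) (F n)" for n
    proof -
      have f0T: "(\<lambda>x. f0 (T x)) \<in> borel_measurable P" by (rule measurable_compose[OF T f0m])
      have "integral\<^sup>L (K n) (\<lambda>x. f (T x)) = integral\<^sup>L (K n) (\<lambda>x. f0 (T x))"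
        using measurable_compose[OF T fm] f0T AE_K[OF \<open>AE x in P. f (T x) = f0 (T x)\<close>] sK
        by (intro integral_cong_AE) (simp_all cong: measurable_cong_sets)
      also have "\<dots> = (\<integral>w. (\<integral>u. f0 (T (fun_splice {..<n} u w)) \<partial>N) \<partial>P)"
        using f0C by (rule Kf[OF f0T])
      also have "\<dots> = (\<integral>w. F n (T w) \<partial>P)"
      proof (intro Bochner_Integration.integral_cong refl)
        fix w assume w: "w \<in> space P"
        have sm: "(\<lambda>u. fun_splice {..<n} u (T w)) \<in> N \<rightarrow>\<^sub>M P"
        proof -
          have "(\<lambda>(u, w). fun_splice {..<n} u w) \<in> N \<Otimes>\<^sub>M P \<rightarrow>\<^sub>M P"
            unfolding N_def P_def by (rule measurable_fun_splice) (auto simp: s)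
          moreover have "T w \<in> space P" using w measurable_space[OF T] by blast
          ultimately show ?thesis using measurable_Pair1 by fastforce
        qed
        have "F n (T w) = (\<integral>u. f0 (fun_splice {..<n} u (T w)) \<partial>distr N N T)"
          by (simp add: F_def T_def TN)
        also have "\<dots> = (\<integral>u. f0 (fun_splice {..<n} (T u) (T w)) \<partial>N)"
          using Tm(2)[of g] measurable_compose[OF sm f0m] by (intro integral_distr) (auto simp: T_def)
        finally show "(\<integral>u. f0 (T (fun_splice {..<n} u w)) \<partial>N) = F n (T w)"
          by (simp add: T_def fun_splice_product_action)
      qed
      also have "\<dots> = integral\<^sup>L (distr P P T) (F n)" by (rule integral_distr[OF T Fm, symmetric])
      finally show ?thesis .
    qed
    have "finite_measure (distr P P T)" using P.prob_space_distr[OF T] by (simp add: prob_space.finite_measure)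
    then obtain h where h: "h \<in> borel_measurable P" "integrable P h" "\<And>x. 0 \<le> h x" "distr P P T = density P h"
      using P.real_density_exists[of "distr P P T"] ns unfolding T_def by auto
    \<comment> \<open>Centring: as \<open>h\<close> has integral 1, the integral of
      \<open>G n * h\<close> is that of \<open>F n * h\<close> minus that of \<open>F n\<close>,
      which is the defect of invariance of \<open>K n\<close>.\<close>
    define G where "G n w = F n w - integral\<^sup>L P (F n)" for n w
    interpret Q: prob_space "density P h" using P.prob_space_distr[OF T] by (simp add: h(4))
    have FQ: "integrable (density P h) (F n)" for n
      using Fm FC by (intro Q.integrable_const_bound[of _ "\<bar>C\<bar>"]) auto
    have FP: "integrable P (F n)" for n
      using Fm FC by (intro P.integrable_const_bound[of _ "\<bar>C\<bar>"]) auto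
    have "(\<lambda>n. \<integral>w. G n w * h w \<partial>P) \<longlonglongrightarrow> 0"
      unfolding P_def
    proof (rule tail_functions_decorrelate[OF M])
      show "G n \<in> borel_measurable (PiM UNIV M)" for n
        using Fm by (simp add: G_def[abs_def] P_def)
      show "\<bar>G n w\<bar> \<le> 2 * \<bar>C\<bar>" for n w
      proof -
        have "\<bar>integral\<^sup>L P (F n)\<bar> \<le> \<bar>C\<bar>"
          by (rule abs_integral_le_AE_bound) (use FC P.prob_space_axioms in auto)
        with FC[of n w] show ?thesis unfolding G_def by linarith
      qed
      show "G n v = G n w" if "\<And>k. n \<le> k \<Longrightarrow> v k = w k" for n v w
        using Ftail[OF that] by (simp add: G_def)
      show "integral\<^sup>L (PiM UNIV M) (G n) = 0" for n
        unfolding P_def[symmetric] G_def using FP by (simp add: P.prob_space)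
      show "integrable (PiM UNIV M) h" using h(2) by (simp add: P_def)
    qed
    moreover have "(\<integral>w. G n w * h w \<partial>P) = integral\<^sup>L (K n) (\<lambda>x. f (T x)) - integral\<^sup>L (K n) f" for n
    proof -
      have Gm: "G n \<in> borel_measurable P" using Fm by (simp add: G_def[abs_def])
      have "(\<integral>w. G n w * h w \<partial>P) = integral\<^sup>L (density P h) (G n)"
        using integral_density[OF Gm h(1)] h(3) by (simp add: mult.commute)
      also have "\<dots> = integral\<^sup>L (density P h) (F n) - integral\<^sup>L P (F n)"
        unfolding G_def using FQ Q.prob_space by simp
      finally show ?thesis by (simp add: K1 K2 h(4))
    qed
    ultimately show "(\<lambda>n. integral\<^sup>L (K n) (\<lambda>x. f (product_action S g x)) - integral\<^sup>L (K n) f) \<longlonglongrightarrow> 0"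
      by (simp add: T_def)
  qed
qed

section \<open>From Zimmer amenability to amenability of the group\<close>

lemma Linf_add: "f \<in> Linf M \<Longrightarrow> f' \<in> Linf M \<Longrightarrow> (\<lambda>x. f x + f' x) \<in> Linf M"
proof -
  assume "f \<in> Linf M" "f' \<in> Linf M"
  then obtain C C' where [measurable]: "f \<in> borel_measurable M" "f' \<in> borel_measurable M"
    and C: "AE x in M. \<bar>f x\<bar> \<le> C" "AE x in M. \<bar>f' x\<bar> \<le> C'"
    by (auto simp: Linf_def)
  from C have "AE x in M. \<bar>f x + f' x\<bar> \<le> C + C'" by eventually_elim linarith
  then show ?thesis by (auto simp: Linf_def)
qed

lemma Linf_scale: "f \<in> Linf M \<Longrightarrow> (\<lambda>x. c * f x) \<in> Linf M"
proof -
  assume "f \<in> Linf M"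
  then obtain C where [measurable]: "f \<in> borel_measurable M" and C: "AE x in M. \<bar>f x\<bar> \<le> C"
    by (auto simp: Linf_def)
  from C have "AE x in M. \<bar>c * f x\<bar> \<le> \<bar>c\<bar> * C" by eventually_elim (simp add: abs_mult mult_left_mono)
  then show ?thesis by (auto simp: Linf_def)
qed

lemma Linf_const: "(\<lambda>_. c) \<in> Linf M"
  by (auto simp: Linf_def)

lemmas mean_cong =
  mean_on_Linf_def[THEN iffD1, THEN conjunct1, rule_format]
lemmas mean_add =
  mean_on_Linf_def[THEN iffD1, THEN conjunct2, THEN conjunct1, rule_format]
lemmas mean_scale =
  mean_on_Linf_def[THEN iffD1, THEN conjunct2, THEN conjunct2, THEN conjunct1, rule_format]
lemmas mean_nonneg =
  mean_on_Linf_def[THEN iffD1, THEN conjunct2, THEN conjunct2, THEN conjunct2, THEN conjunct1, rule_format]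
lemmas mean_one =
  mean_on_Linf_def[THEN iffD1, THEN conjunct2, THEN conjunct2, THEN conjunct2, THEN conjunct2, rule_format]

lemma mean_diff:
  assumes m: "mean_on_Linf M m" and f: "f \<in> Linf M" "f' \<in> Linf M"
  shows "m (\<lambda>x. f x - f' x) = m f - m f'"
  using mean_add[OF m f(1) Linf_scale[OF f(2)], of "- 1"] mean_scale[OF m f(2), of "- 1"] by simp

lemma mean_mono:
  assumes m: "mean_on_Linf M m" and f: "f \<in> Linf M" "f' \<in> Linf M" "AE x in M. f x \<le> f' x"
  shows "m f \<le> m f'"
proof -
  have "(\<lambda>x. f' x + - 1 * f x) \<in> Linf M" by (intro Linf_add Linf_scale f)
  then have "0 \<le> m (\<lambda>x. f' x - f x)"
    using f(3) by (intro mean_nonneg[OF m]) simp_all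
  then show ?thesis by (simp add: mean_diff[OF m f(2,1)])
qed

lemma mean_const: "mean_on_Linf M m \<Longrightarrow> m (\<lambda>_. c) = c"
  using mean_scale[OF _ Linf_const[of 1 M], of m c] mean_one[of M m] by simp

lemma mean_abs_le:
  assumes m: "mean_on_Linf M m" and f: "f \<in> Linf M" "AE x in M. \<bar>f x\<bar> \<le> C"
  shows "\<bar>m f\<bar> \<le> C"
proof -
  have "m f \<le> m (\<lambda>_. C)"
    by (rule mean_mono[OF m f(1) Linf_const]) (use f(2) in eventually_elim, simp)
  moreover have "m (\<lambda>_. - C) \<le> m f"
    by (rule mean_mono[OF m Linf_const f(1)]) (use f(2) in eventually_elim, simp)
  ultimately show ?thesis by (simp add: mean_const[OF m])
qed

lemmas positive_map_Linf =
  positive_unital_linear_map_def[THEN iffD1, THEN conjunct1, rule_format]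
lemmas positive_map_cong =
  positive_unital_linear_map_def[THEN iffD1, THEN conjunct2, THEN conjunct1, rule_format]
lemmas positive_map_add =
  positive_unital_linear_map_def[THEN iffD1, THEN conjunct2, THEN conjunct2, THEN conjunct1, rule_format]
lemmas positive_map_scale =
  positive_unital_linear_map_def[THEN iffD1, THEN conjunct2, THEN conjunct2, THEN conjunct2, THEN conjunct1, rule_format]
lemmas positive_map_nonneg =
  positive_unital_linear_map_def[THEN iffD1, THEN conjunct2, THEN conjunct2, THEN conjunct2, THEN conjunct2, THEN conjunct1, rule_format]
lemmas positive_map_one =
  positive_unital_linear_map_def[THEN iffD1, THEN conjunct2, THEN conjunct2, THEN conjunct2, THEN conjunct2, THEN conjunct2, rule_format]

text \<open>Fubini with the variables exchanged; the slices needed later are those at a fixed group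
  element.\<close>

lemma (in pair_sigma_finite) AE_pair_flipped:
  assumes "AE z in M1 \<Otimes>\<^sub>M M2. Q z"
  shows "AE y in M2. AE x in M1. Q (x, y)"
proof -
  interpret Q: pair_sigma_finite M2 M1 ..
  have "AE z in M2 \<Otimes>\<^sub>M M1. Q (case z of (x, y) \<Rightarrow> (y, x))"
    by (rule AE_distrD[OF measurable_pair_swap']) (use assms in \<open>simp only: distr_pair_swap[symmetric]\<close>)
  from Q.AE_pair[OF this] show ?thesis by simp
qed

text \<open>The exceptional set lies in \<open>space M1 \<times> N\<close> with \<open>N\<close>
  null, a null set even when \<open>M1\<close> is infinite.\<close>

lemma (in pair_sigma_finite) AE_pair_snd:
  assumes "AE y in M2. Q y"
  shows "AE z in M1 \<Otimes>\<^sub>M M2. Q (snd z)"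
proof -
  obtain N where N: "N \<in> null_sets M2" "{y\<in>space M2. \<not> Q y} \<subseteq> N"
    using assms by (auto simp: eventually_ae_filter)
  have "space M1 \<times> N \<in> null_sets (M1 \<Otimes>\<^sub>M M2)"
    using N(1) by (auto simp: null_sets_def M2.emeasure_pair_measure_Times)
  then show ?thesis
    by (rule AE_I') (use N(2) in \<open>auto simp: space_pair_measure\<close>)
qed

lemma Linf_snd:
  assumes "sigma_finite_measure M" "sigma_finite_measure N" "f \<in> Linf N"
  shows "(\<lambda>(x, h). f h) \<in> Linf (M \<Otimes>\<^sub>M N)"
proof -
  interpret M: sigma_finite_measure M by fact
  interpret N: sigma_finite_measure N by fact
  interpret pair_sigma_finite M N ..
  obtain C where [measurable]: "f \<in> borel_measurable N" and C: "AE x in N. \<bar>f x\<bar> \<le> C"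
    using assms(3) by (auto simp: Linf_def)
  have "(\<lambda>(x, h). f h) \<in> borel_measurable (M \<Otimes>\<^sub>M N)" by measurable
  moreover have "AE z in M \<Otimes>\<^sub>M N. \<bar>f (snd z)\<bar> \<le> C" by (rule AE_pair_snd[OF C])
  ultimately show ?thesis by (auto simp: Linf_def split_def)
qed

lemma zimmer_greenleaf_imp_amenable_group:
  fixes haar :: "'g::topological_group_add measure"
  assumes M: "prob_space M" and haar: "sigma_finite_measure haar"
    and T: "\<And>g. T g \<in> M \<rightarrow>\<^sub>M M" "\<And>g. absolutely_continuous M (distr M M (T g))"
    and inv: "\<And>g f. f \<in> Linf haar \<Longrightarrow> (\<lambda>x. f (g + x)) \<in> Linf haar"
    and "greenleaf_amenable M T" "zimmer_amenable haar M T"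
  shows "amenable_group haar"
proof -
  interpret M: prob_space M by fact
  interpret haar: sigma_finite_measure haar by fact
  interpret pair_sigma_finite M haar ..
  obtain m where m: "mean_on_Linf M m" and minv: "\<And>g f. f \<in> Linf M \<Longrightarrow> m (\<lambda>x. f (T g x)) = m f"
    using assms(6) by (auto simp: greenleaf_amenable_def)
  obtain P where P: "positive_unital_linear_map (M \<Otimes>\<^sub>M haar) M P"
    and equiv: "\<And>g F. F \<in> Linf (M \<Otimes>\<^sub>M haar) \<Longrightarrow> AE x in M. P (\<lambda>(x, h). F (T g x, g + h)) x = P F (T g x)"
    using assms(7) by (auto simp: zimmer_amenable_def)
  define L where "L f = (\<lambda>(x :: 'a, h :: 'g). f h :: real)" for f
  have L: "L f \<in> Linf (M \<Otimes>\<^sub>M haar)" if "f \<in> Linf haar" for f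
    unfolding L_def using that by (intro Linf_snd) unfold_locales
  have P_in: "P F \<in> Linf M" if "F \<in> Linf (M \<Otimes>\<^sub>M haar)" for F
    using P that by (rule positive_map_Linf)
  define m' where "m' f = m (P (L f))" for f
  have "mean_on_Linf haar m'"
    unfolding mean_on_Linf_def
  proof (intro conjI ballI impI allI)
    fix f f' assume f: "f \<in> Linf haar" "f' \<in> Linf haar" and eq: "AE x in haar. f x = f' x"
    have "AE z in M \<Otimes>\<^sub>M haar. L f z = L f' z"
      using AE_pair_snd[OF eq] by (simp add: L_def split_def)
    then have "AE y in M. P (L f) y = P (L f') y"
      by (rule positive_map_cong[OF P L[OF f(1)] L[OF f(2)]])
    then show "m' f = m' f'" unfolding m'_def by (intro mean_cong[OF m] P_in L f)
  next
    fix f f' assume f: "f \<in> Linf haar" "f' \<in> Linf haar"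
    have "AE y in M. P (\<lambda>z. L f z + L f' z) y = P (L f) y + P (L f') y"
      by (rule positive_map_add[OF P L[OF f(1)] L[OF f(2)]])
    then have "m (P (\<lambda>z. L f z + L f' z)) = m (\<lambda>y. P (L f) y + P (L f') y)"
      by (intro mean_cong[OF m] P_in L f Linf_add)
    also have "\<dots> = m' f + m' f'"
      unfolding m'_def by (rule mean_add[OF m P_in[OF L[OF f(1)]] P_in[OF L[OF f(2)]]])
    finally show "m' (\<lambda>x. f x + f' x) = m' f + m' f'" by (simp add: m'_def L_def split_def)
  next
    fix f c assume f: "f \<in> Linf haar"
    have "AE y in M. P (\<lambda>z. c * L f z) y = c * P (L f) y"
      by (rule positive_map_scale[OF P L[OF f]])
    then have "m (P (\<lambda>z. c * L f z)) = m (\<lambda>y. c * P (L f) y)"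
      by (intro mean_cong[OF m] P_in L f Linf_scale)
    also have "\<dots> = c * m' f"
      unfolding m'_def by (rule mean_scale[OF m P_in[OF L[OF f]]])
    finally show "m' (\<lambda>x. c * f x) = c * m' f" by (simp add: m'_def L_def split_def)
  next
    fix f assume f: "f \<in> Linf haar" "AE x in haar. 0 \<le> f x"
    have "AE z in M \<Otimes>\<^sub>M haar. 0 \<le> L f z"
      using AE_pair_snd[OF f(2)] by (simp add: L_def split_def)
    then have "AE y in M. 0 \<le> P (L f) y"
      by (rule positive_map_nonneg[OF P L[OF f(1)]])
    then show "0 \<le> m' f" unfolding m'_def by (rule mean_nonneg[OF m P_in[OF L[OF f(1)]]])
  next
    have "AE y in M. P (\<lambda>_. 1) y = 1" by (rule positive_map_one[OF P])
    then have "m (P (\<lambda>_. 1)) = m (\<lambda>_. 1)" by (intro mean_cong[OF m] P_in Linf_const)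
    then show "m' (\<lambda>_. 1) = 1" using mean_const[OF m] by (simp add: m'_def L_def split_def)
  qed
  moreover have "m' (\<lambda>x. f (g + x)) = m' f" if f: "f \<in> Linf haar" for g f
  proof -
    \<comment> \<open>\<open>L f\<close> ignores the first variable, so composing it with the
      diagonal action is the same as translating \<open>f\<close>. Equivariance moves
      \<open>T g\<close> outside \<open>P\<close>, where the invariance of \<open>m\<close> removes
      it.\<close>
    have "AE x in M. P (L (\<lambda>x. f (g + x))) x = P (L f) (T g x)"
      using equiv[OF L[OF f], of g] by (simp add: L_def)
    then have "m (P (L (\<lambda>x. f (g + x)))) = m (\<lambda>x. P (L f) (T g x))"
      by (intro mean_cong[OF m] P_in L inv f Linf_comp[OF P_in[OF L[OF f]] T])
    also have "\<dots> = m (P (L f))" by (rule minv[OF P_in[OF L[OF f]]])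
    finally show ?thesis by (simp add: m'_def)
  qed
  ultimately show ?thesis unfolding amenable_group_def by blast
qed

text \<open>Local compactness covers the group by open subsets of compact sets, each of finite
  measure; by Lindelof countably many of them suffice.\<close>

lemma sigma_finite_left_haar_measure:
  fixes haar :: "'g::{topological_group_add, second_countable_topology, t2_space} measure"
  assumes lc: "locally_compact_space (euclidean :: 'g topology)" and haar: "left_haar_measure haar"
  shows "sigma_finite_measure haar"
proof -
  have s: "sets haar = sets borel" and fin: "\<And>K. compact K \<Longrightarrow> emeasure haar K < \<infinity>"
    using haar by (auto simp: left_haar_measure_def)
  let ?F = "{U :: 'g set. open U \<and> (\<exists>K. compact K \<and> U \<subseteq> K)}"
  obtain F' where F': "F' \<subseteq> ?F" "countable F'" "\<Union>F' = \<Union>?F"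
    using Lindelof[of ?F] by blast
  have "x \<in> \<Union>?F" for x
  proof -
    obtain U K where "open U" "compact K" "x \<in> U" "U \<subseteq> K"
      using lc unfolding locally_compact_space_def open_openin[symmetric] compactin_euclidean_iff
      by (metis UNIV_I topspace_euclidean)
    then show ?thesis by auto
  qed
  then have "\<Union>?F = UNIV" by (intro equalityI subsetI UNIV_I)
  then have cover: "\<Union>F' = space haar"
    unfolding F'(3) sets_eq_imp_space_eq[OF s] space_borel .
  have "emeasure haar U \<noteq> \<infinity>" if "U \<in> F'" for U
  proof -
    have "U \<in> ?F" using F'(1) that by (rule subsetD)
    then obtain K where K: "compact K" "U \<subseteq> K" by blast
    have "emeasure haar U \<le> emeasure haar K"
      using K by (intro emeasure_mono) (auto simp: s borel_compact)
    then show ?thesis using fin[OF K(1)] by (auto simp: top_unique)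
  qed
  then show ?thesis
    using F'(1,2) cover by unfold_locales (auto intro!: exI[of _ F'] simp: s)
qed

lemma Linf_haar_translate:
  fixes haar :: "'g::{topological_group_add, second_countable_topology, t2_space} measure"
  assumes "left_haar_measure haar" "f \<in> Linf haar"
  shows "(\<lambda>x. f (g + x)) \<in> Linf haar"
proof (rule Linf_comp[OF assms(2)])
  have s: "sets haar = sets borel" and d: "distr haar haar (\<lambda>x. g + x) = haar"
    using assms(1) by (auto simp: left_haar_measure_def)
  have "(\<lambda>x. g + x) \<in> borel \<rightarrow>\<^sub>M borel"
    by (intro borel_measurable_continuous_onI continuous_intros)
  then show "(\<lambda>x. g + x) \<in> haar \<rightarrow>\<^sub>M haar" by (simp add: measurable_cong_sets[OF s s])
  show "absolutely_continuous haar (distr haar haar (\<lambda>x. g + x))"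
    by (simp add: d absolutely_continuous_def)
qed

section \<open>From amenability of the group to Zimmer amenability\<close>

lemma Linf_bounded_mult:
  assumes f: "f \<in> Linf M" and p: "integrable M p"
  shows "integrable M (\<lambda>x. f x * p x)"
proof -
  obtain C where [measurable]: "f \<in> borel_measurable M" and C: "AE x in M. \<bar>f x\<bar> \<le> C"
    using f by (auto simp: Linf_def)
  have pm[measurable]: "p \<in> borel_measurable M" using p by auto
  have i: "integrable M (\<lambda>x. C * p x)" using p by auto
  have b: "AE x in M. norm (f x * p x) \<le> norm (C * p x)"
    using C by eventually_elim (auto simp: abs_mult intro!: mult_right_mono)
  show ?thesis by (rule Bochner_Integration.integrable_bound[OF i _ b]) measurable
qed

text \<open>Test against the indicator of \<open>{f < 0}\<close>: the integral of \<open>f\<close>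
  over that set is at once nonnegative and nonpositive, so the set is null.\<close>

lemma Linf_nonneg_if_integrals_nonneg:
  assumes "finite_measure M" and f: "f \<in> Linf M"
    and nn: "\<And>p. integrable M p \<Longrightarrow> (\<And>x. 0 \<le> p x) \<Longrightarrow> 0 \<le> (\<integral>x. f x * p x \<partial>M)"
  shows "AE x in M. 0 \<le> f x"
proof -
  interpret finite_measure M by fact
  have fm[measurable]: "f \<in> borel_measurable M" using f by (simp add: Linf_def)
  define B where "B = {x\<in>space M. f x < 0}"
  have B[measurable]: "B \<in> sets M" unfolding B_def by measurable
  have iB: "integrable M (indicator B :: _ \<Rightarrow> real)"
    by (intro integrable_real_indicator B) (simp add: emeasure_eq_measure)
  have int: "integrable M (\<lambda>x. - (f x * indicator B x))"
    using Linf_bounded_mult[OF f iB] by simp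
  have nonneg: "AE x in M. 0 \<le> - (f x * indicator B x)"
    by (intro AE_I2) (auto simp: B_def indicator_def)
  have "0 \<le> (\<integral>x. f x * indicator B x \<partial>M)" by (intro nn iB) simp
  then have "(\<integral>x. - (f x * indicator B x) \<partial>M) \<le> 0" by simp
  with integral_nonneg_AE[OF nonneg] have "(\<integral>x. - (f x * indicator B x) \<partial>M) = 0" by linarith
  then have "AE x in M. - (f x * indicator B x) = 0"
    using integral_nonneg_eq_0_iff_AE[OF int nonneg] by blast
  then show ?thesis by (rule AE_mp) (auto simp: B_def indicator_def intro!: AE_I2)
qed

text \<open>Applying \<open>m\<close> to each slice \<open>F(x, _)\<close> need not give a measurable function of \<open>x\<close>; the mean over the
  second variable is therefore characterised by duality with \<open>L\<^sup>1(M)\<close>.\<close>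

definition weak_mean :: "'a measure \<Rightarrow> (('b \<Rightarrow> real) \<Rightarrow> real) \<Rightarrow> ('a \<times> 'b \<Rightarrow> real) \<Rightarrow> ('a \<Rightarrow> real) \<Rightarrow> bool" where
  "weak_mean M m F \<psi> \<longleftrightarrow> \<psi> \<in> Linf M \<and>
     (\<forall>p. integrable M p \<longrightarrow> (\<integral>x. \<psi> x * p x \<partial>M) = m (\<lambda>h. \<integral>x. F (x, h) * p x \<partial>M))"

text \<open>Two weak means pair equally with every integrable function, so both differences are
  nonnegative by \<open>Linf_nonneg_if_integrals_nonneg\<close>.\<close>

lemma weak_mean_unique:
  fixes M :: "'a measure"
  assumes M: "finite_measure M" and "weak_mean M m F \<psi>" "weak_mean M m F \<psi>'"
  shows "AE x in M. \<psi> x = \<psi>' x"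
proof -
  have L: "\<psi> \<in> Linf M" "\<psi>' \<in> Linf M" using assms(2,3) by (auto simp: weak_mean_def)
  have eq: "(\<integral>x. \<psi> x * p x \<partial>M) = (\<integral>x. \<psi>' x * p x \<partial>M)" if "integrable M p" for p :: "'a \<Rightarrow> real"
    using assms(2,3) that by (auto simp: weak_mean_def)
  have "AE x in M. 0 \<le> f x + - 1 * f' x"
    if f: "f \<in> Linf M" "f' \<in> Linf M"
      and eq: "\<And>p :: 'a \<Rightarrow> real. integrable M p \<Longrightarrow> (\<integral>x. f x * p x \<partial>M) = (\<integral>x. f' x * p x \<partial>M)" for f f' :: "'a \<Rightarrow> real"
  proof (rule Linf_nonneg_if_integrals_nonneg[OF M])
    show "(\<lambda>x. f x + - 1 * f' x) \<in> Linf M" by (intro Linf_add Linf_scale f)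
    fix p :: "'a \<Rightarrow> real" assume p: "integrable M p"
    have "(\<integral>x. (f x + - 1 * f' x) * p x \<partial>M) = (\<integral>x. f x * p x - f' x * p x \<partial>M)"
      by (simp add: algebra_simps)
    also have "\<dots> = (\<integral>x. f x * p x \<partial>M) - (\<integral>x. f' x * p x \<partial>M)"
      by (intro Bochner_Integration.integral_diff Linf_bounded_mult f p)
    finally show "0 \<le> (\<integral>x. (f x + - 1 * f' x) * p x \<partial>M)" using eq[OF p] by simp
  qed
  note le = this
  have "AE x in M. 0 \<le> \<psi> x + - 1 * \<psi>' x" by (rule le[OF L eq])
  moreover have "AE x in M. 0 \<le> \<psi>' x + - 1 * \<psi> x" by (rule le[OF L(2,1) eq[symmetric]])
  ultimately show ?thesis by eventually_elim simp
qed

section \<open>Existence and calculus of weak means\<close>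

locale mean_pair = M: prob_space M + N: sigma_finite_measure N
  for M :: "'a measure" and N :: "'b measure" +
  fixes m :: "('b \<Rightarrow> real) \<Rightarrow> real"
  assumes m: "mean_on_Linf N m"
begin

sublocale MN: pair_sigma_finite M N ..

lemma partial_integral_measurable:
  fixes p :: "'a \<Rightarrow> real"
  assumes "F \<in> borel_measurable (M \<Otimes>\<^sub>M N)" "p \<in> borel_measurable M"
  shows "(\<lambda>h. \<integral>x. F (x, h) * p x \<partial>M) \<in> borel_measurable N"
proof -
  have "(\<lambda>z. F (snd z, fst z)) \<in> borel_measurable (N \<Otimes>\<^sub>M M)"
    using measurable_compose[OF measurable_pair_swap' assms(1)] by (simp add: split_def)
  moreover have "(\<lambda>z. p (snd z)) \<in> borel_measurable (N \<Otimes>\<^sub>M M)"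
    by (rule measurable_compose[OF measurable_snd assms(2)])
  ultimately have "(\<lambda>z. F (snd z, fst z) * p (snd z)) \<in> borel_measurable (N \<Otimes>\<^sub>M M)"
    by (rule borel_measurable_times)
  then show ?thesis by (intro M.borel_measurable_lebesgue_integral) (simp add: split_def)
qed

text \<open>Fubini turns the bound on the product into one constant valid for almost every slice, so
  that later estimates are uniform in \<open>h\<close>.\<close>

lemma AE_slice_Linf:
  assumes "F \<in> Linf (M \<Otimes>\<^sub>M N)"
  obtains C where "AE h in N. (\<lambda>x. F (x, h)) \<in> borel_measurable M \<and> (AE x in M. \<bar>F (x, h)\<bar> \<le> C)"
proof -
  obtain C where F: "F \<in> borel_measurable (M \<Otimes>\<^sub>M N)" and C: "AE z in M \<Otimes>\<^sub>M N. \<bar>F z\<bar> \<le> C"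
    using assms by (auto simp: Linf_def)
  have "AE h in N. (\<lambda>x. F (x, h)) \<in> borel_measurable M"
    by (intro AE_I2 measurable_Pair1[OF F])
  moreover have "AE h in N. AE x in M. \<bar>F (x, h)\<bar> \<le> C" by (rule MN.AE_pair_flipped[OF C])
  ultimately have "AE h in N. (\<lambda>x. F (x, h)) \<in> borel_measurable M \<and> (AE x in M. \<bar>F (x, h)\<bar> \<le> C)"
    by eventually_elim simp
  then show ?thesis by (rule that)
qed

lemma AE_slice_integrable:
  assumes "F \<in> Linf (M \<Otimes>\<^sub>M N)" "integrable M p"
  shows "AE h in N. integrable M (\<lambda>x. F (x, h) * p x)"
proof -
  obtain C where "AE h in N. (\<lambda>x. F (x, h)) \<in> borel_measurable M \<and> (AE x in M. \<bar>F (x, h)\<bar> \<le> C)"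
    using AE_slice_Linf[OF assms(1)] .
  then show ?thesis
  proof eventually_elim
    case (elim h)
    then have "(\<lambda>x. F (x, h)) \<in> Linf M" by (auto simp: Linf_def)
    then show ?case by (rule Linf_bounded_mult[OF _ assms(2)])
  qed
qed

text \<open>\<open>C\<close> depends only on \<open>F\<close>: pairing with \<open>F\<close> and
  applying \<open>m\<close> is a bounded functional of \<open>p\<close> on \<open>L^1\<close>. The
  measure built from \<open>F\<close> and the passage to limits in \<open>p\<close> both rest on
  this.\<close>

lemma partial_integral_bound:
  assumes F: "F \<in> Linf (M \<Otimes>\<^sub>M N)"
  obtains C where "\<And>p. integrable M p \<Longrightarrow> (\<lambda>h. \<integral>x. F (x, h) * p x \<partial>M) \<in> Linf N"
    "\<And>p. integrable M p \<Longrightarrow> \<bar>m (\<lambda>h. \<integral>x. F (x, h) * p x \<partial>M)\<bar> \<le> C * (\<integral>x. \<bar>p x\<bar> \<partial>M)"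
proof -
  obtain C where C: "AE h in N. (\<lambda>x. F (x, h)) \<in> borel_measurable M \<and> (AE x in M. \<bar>F (x, h)\<bar> \<le> C)"
    using AE_slice_Linf[OF F] .
  have bd: "AE h in N. \<bar>\<integral>x. F (x, h) * p x \<partial>M\<bar> \<le> C * (\<integral>x. \<bar>p x\<bar> \<partial>M)" if p: "integrable M p" for p
    using C AE_slice_integrable[OF F p]
  proof eventually_elim
    case (elim h)
    have "\<bar>\<integral>x. F (x, h) * p x \<partial>M\<bar> \<le> (\<integral>x. \<bar>F (x, h) * p x\<bar> \<partial>M)" by (rule integral_abs_bound)
    also have "\<dots> \<le> (\<integral>x. C * \<bar>p x\<bar> \<partial>M)"
    proof (rule integral_mono_AE)
      have "AE x in M. \<bar>F (x, h)\<bar> \<le> C" using elim by simp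
      then show "AE x in M. \<bar>F (x, h) * p x\<bar> \<le> C * \<bar>p x\<bar>"
        by eventually_elim (auto simp: abs_mult intro!: mult_right_mono)
    qed (use elim p in auto)
    finally show ?case by simp
  qed
  have L: "(\<lambda>h. \<integral>x. F (x, h) * p x \<partial>M) \<in> Linf N" if p: "integrable M p" for p
  proof -
    have "(\<lambda>h. \<integral>x. F (x, h) * p x \<partial>M) \<in> borel_measurable N"
      using F p by (intro partial_integral_measurable) (auto simp: Linf_def)
    then show ?thesis using bd[OF p] unfolding Linf_def by blast
  qed
  show thesis by (rule that[of C, OF L mean_abs_le[OF m L bd]])
qed

lemma partial_integral_Linf:
  "F \<in> Linf (M \<Otimes>\<^sub>M N) \<Longrightarrow> integrable M p \<Longrightarrow> (\<lambda>h. \<integral>x. F (x, h) * p x \<partial>M) \<in> Linf N"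
  by (rule partial_integral_bound)

lemma mean_partial_integral_add:
  assumes F: "F \<in> Linf (M \<Otimes>\<^sub>M N)" and p: "integrable M p" "integrable M q"
  shows "m (\<lambda>h. \<integral>x. F (x, h) * (p x + q x) \<partial>M) =
    m (\<lambda>h. \<integral>x. F (x, h) * p x \<partial>M) + m (\<lambda>h. \<integral>x. F (x, h) * q x \<partial>M)"
proof -
  note L = partial_integral_Linf[OF F]
  have "AE h in N. (\<integral>x. F (x, h) * (p x + q x) \<partial>M) = (\<integral>x. F (x, h) * p x \<partial>M) + (\<integral>x. F (x, h) * q x \<partial>M)"
    using AE_slice_integrable[OF F p(1)] AE_slice_integrable[OF F p(2)]
    by eventually_elim (simp add: distrib_left)
  then have "m (\<lambda>h. \<integral>x. F (x, h) * (p x + q x) \<partial>M) =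
      m (\<lambda>h. (\<integral>x. F (x, h) * p x \<partial>M) + (\<integral>x. F (x, h) * q x \<partial>M))"
    using p by (intro mean_cong[OF m] Linf_add L) auto
  also have "\<dots> = m (\<lambda>h. \<integral>x. F (x, h) * p x \<partial>M) + m (\<lambda>h. \<integral>x. F (x, h) * q x \<partial>M)"
    by (intro mean_add[OF m] L p)
  finally show ?thesis .
qed

lemma mean_partial_integral_scale:
  assumes F: "F \<in> Linf (M \<Otimes>\<^sub>M N)" and p: "integrable M p"
  shows "m (\<lambda>h. \<integral>x. F (x, h) * (c * p x) \<partial>M) = c * m (\<lambda>h. \<integral>x. F (x, h) * p x \<partial>M)"
proof -
  have "(\<integral>x. F (x, h) * (c * p x) \<partial>M) = c * (\<integral>x. F (x, h) * p x \<partial>M)" for h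
    by (simp add: mult.left_commute)
  then show ?thesis using mean_scale[OF m partial_integral_Linf[OF F p], of c] by simp
qed

lemma mean_partial_integral_nonneg:
  assumes F: "F \<in> Linf (M \<Otimes>\<^sub>M N)" "AE z in M \<Otimes>\<^sub>M N. 0 \<le> F z" and p: "integrable M p" "\<And>x. 0 \<le> p x"
  shows "0 \<le> m (\<lambda>h. \<integral>x. F (x, h) * p x \<partial>M)"
proof (rule mean_nonneg[OF m partial_integral_Linf[OF F(1) p(1)]])
  show "AE h in N. 0 \<le> (\<integral>x. F (x, h) * p x \<partial>M)"
    using MN.AE_pair_flipped[OF F(2)]
    by eventually_elim (auto intro!: integral_nonneg_AE elim!: eventually_mono simp: p(2))
qed

text \<open>By finite additivity and domination by \<open>M\<close>, \<open>A \<mapsto> m(h \<mapsto> \<integral>F(x, h) 1\<^sub>A(x) dM(x))\<close> is a measure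
  absolutely continuous with respect to \<open>M\<close>; its density extends the formula to integrable \<open>p\<close>.\<close>

lemma weak_mean_exists_nonneg:
  assumes F: "F \<in> Linf (M \<Otimes>\<^sub>M N)" "AE z in M \<Otimes>\<^sub>M N. 0 \<le> F z"
  shows "\<exists>\<psi>. weak_mean M m F \<psi>"
proof -
  define I where "I p = m (\<lambda>h. \<integral>x. F (x, h) * p x \<partial>M)" for p
  obtain C where "integrable M p \<Longrightarrow> \<bar>m (\<lambda>h. \<integral>x. F (x, h) * p x \<partial>M)\<bar> \<le> C * (\<integral>x. \<bar>p x\<bar> \<partial>M)" for p
    by (rule partial_integral_bound[OF F(1)]) blast
  then have C: "integrable M p \<Longrightarrow> \<bar>I p\<bar> \<le> C * (\<integral>x. \<bar>p x\<bar> \<partial>M)" for p by (simp only: I_def)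
  define \<rho> where "\<rho> A = I (indicator A)" for A
  have ind: "integrable M (indicator A :: _ \<Rightarrow> real)" if "A \<in> sets M" for A
    using that by (intro integrable_real_indicator) (auto simp: M.emeasure_eq_measure)
  have \<rho>0: "0 \<le> \<rho> A" if "A \<in> sets M" for A
    unfolding \<rho>_def I_def by (rule mean_partial_integral_nonneg[OF F ind[OF that]]) simp
  have \<rho>C: "\<rho> A \<le> C * measure M A" if "A \<in> sets M" for A
    using C[OF ind[OF that]] that by (simp add: \<rho>_def)
  have \<rho>_add: "\<rho> (A \<union> B) = \<rho> A + \<rho> B" if "A \<in> sets M" "B \<in> sets M" "A \<inter> B = {}" for A B
  proof -
    have "(indicator (A \<union> B) :: _ \<Rightarrow> real) = (\<lambda>x. indicator A x + indicator B x)"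
      using that(3) by (auto simp: indicator_def fun_eq_iff)
    then show ?thesis
      unfolding \<rho>_def I_def using mean_partial_integral_add[OF F(1) ind[OF that(1)] ind[OF that(2)]] by simp
  qed
  define R where "R = measure_of (space M) (sets M) (\<lambda>A. ennreal (\<rho> A))"
  \<comment> \<open>The mean \<open>m\<close> is only finitely additive; countable additivity of
    \<rho> comes from \<open>\<rho> A \<le> C * measure M A\<close>, which forces continuity at the
    empty set.\<close>
  have "countably_additive (sets M) (\<lambda>A. ennreal (\<rho> A))"
  proof (rule sets.empty_continuous_imp_countably_additive)
    have "\<rho> {} = 0" using \<rho>_add[of "{}" "{}"] by simp
    then show "positive (sets M) (\<lambda>A. ennreal (\<rho> A))" by (simp add: positive_def)
    show "additive (sets M) (\<lambda>A. ennreal (\<rho> A))"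
      using \<rho>_add \<rho>0 by (simp add: additive_def)
    show "\<forall>A\<in>sets M. ennreal (\<rho> A) \<noteq> \<infinity>" by simp
    fix A :: "nat \<Rightarrow> _" assume A: "range A \<subseteq> sets M" "decseq A" "(\<Inter>i. A i) = {}"
    have "(\<lambda>i. C * measure M (A i)) \<longlonglongrightarrow> C * measure M (\<Inter>i. A i)"
      by (intro tendsto_mult_left M.finite_Lim_measure_decseq A)
    then have lim: "(\<lambda>i. C * measure M (A i)) \<longlonglongrightarrow> 0" using A(3) by simp
    have "(\<lambda>i. \<rho> (A i)) \<longlonglongrightarrow> 0"
      by (rule tendsto_sandwich[OF _ _ tendsto_const lim]) (use A(1) in \<open>auto intro!: always_eventually \<rho>0 \<rho>C\<close>)
    then show "(\<lambda>i. ennreal (\<rho> (A i))) \<longlonglongrightarrow> 0" using tendsto_ennrealI by force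
  qed
  then have R: "emeasure R A = ennreal (\<rho> A)" if "A \<in> sets M" for A
    unfolding R_def using that \<rho>_add[of "{}" "{}"]
    by (intro emeasure_measure_of[OF refl]) (simp_all add: positive_def sets.space_closed)
  have sR: "sets R = sets M" and spR: "space R = space M" unfolding R_def by simp_all
  have finR: "finite_measure R" by (rule finite_measureI) (simp add: spR R)
  have acR: "absolutely_continuous M R"
    unfolding absolutely_continuous_def
  proof
    fix A assume A: "A \<in> null_sets M"
    then have "\<rho> A \<le> 0" using \<rho>C[of A] by (auto simp: measure_eq_0_null_sets)
    then show "A \<in> null_sets R" using A by (auto simp: null_sets_def sR R ennreal_neg)
  qed
  obtain h where hm[measurable]: "h \<in> borel_measurable M" and h: "integrable M h" "\<And>x. 0 \<le> h x" "R = density M h"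
    using M.real_density_exists[OF finR sR acR] by blast
  have h\<rho>: "(\<integral>x. h x * indicator A x \<partial>M) = \<rho> A" if A: "A \<in> sets M" for A
  proof -
    have "(\<integral>x. h x * indicator A x \<partial>M) = integral\<^sup>L R (indicator A)"
      using integral_density[OF _ hm, of "indicator A :: 'a \<Rightarrow> real"] A h(2,3) by simp
    also have "\<dots> = measure R A" using A by (simp add: sR spR)
    also have "\<dots> = \<rho> A" using R[OF A] \<rho>0[OF A] by (simp add: measure_def)
    finally show ?thesis .
  qed
  \<comment> \<open>On \<open>B\<close>, where \<open>C < h x\<close>, the integral of
    \<open>h x - C\<close> is \<open>\<rho> B - C * measure M B\<close>, which is at most 0; hence
    \<open>B\<close> is null.\<close>
  have hC: "AE x in M. h x \<le> C"
  proof -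
    define B where "B = {x\<in>space M. C < h x}"
    have B: "B \<in> sets M" unfolding B_def by measurable
    have ih: "integrable M (\<lambda>x. h x * indicator B x)"
      using integrable_mult_indicator[OF B h(1)] by (simp add: mult.commute)
    have ic: "integrable M (\<lambda>x. C * indicator B x)" using ind[OF B] by simp
    have "(\<integral>x. h x * indicator B x - C * indicator B x \<partial>M) = \<rho> B - C * measure M B"
      using ih ic B h\<rho>[OF B] by (subst Bochner_Integration.integral_diff) auto
    also have "\<dots> \<le> 0" using \<rho>C[OF B] by simp
    finally have le: "(\<integral>x. h x * indicator B x - C * indicator B x \<partial>M) \<le> 0" .
    have nonneg: "AE x in M. 0 \<le> h x * indicator B x - C * indicator B x"
      by (intro AE_I2) (auto simp: B_def indicator_def)
    have "AE x in M. h x * indicator B x - C * indicator B x = 0"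
      using integral_nonneg_eq_0_iff_AE[OF Bochner_Integration.integrable_diff[OF ih ic] nonneg]
        integral_nonneg_AE[OF nonneg] le by linarith
    then show ?thesis by (rule AE_mp) (auto simp: B_def indicator_def intro!: AE_I2)
  qed
  have hL: "h \<in> Linf M"
    using hC h(2) unfolding Linf_def by (auto intro!: exI[of _ C])
  \<comment> \<open>Agreement on indicators extends by linearity and then, both sides being
    \<open>L^1\<close> continuous with constant \<open>C\<close>, to limits.\<close>
  have "(\<integral>x. h x * p x \<partial>M) = I p" if "integrable M p" for p
    using that
  proof (induction rule: integrable_induct)
    case (base A c)
    have "I (\<lambda>x. c * indicator A x) = c * \<rho> A"
      unfolding \<rho>_def I_def by (rule mean_partial_integral_scale[OF F(1) ind[OF base(1)]])
    moreover have "(\<integral>x. h x * (c * indicator A x) \<partial>M) = c * \<rho> A"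
      using h\<rho>[OF base(1)] by (simp add: mult.left_commute)
    ultimately show ?case by (simp add: mult.commute)
  next
    case (add p q)
    have "(\<integral>x. h x * (p x + q x) \<partial>M) = (\<integral>x. h x * p x \<partial>M) + (\<integral>x. h x * q x \<partial>M)"
      unfolding distrib_left by (intro Bochner_Integration.integral_add Linf_bounded_mult hL add)
    then show ?case
      unfolding I_def mean_partial_integral_add[OF F(1) add(1,2)] using add.IH by (simp add: I_def)
  next
    case (lim p s)
    define d where "d i x = p x - s i x" for i x
    have di: "integrable M (d i)" for i unfolding d_def using lim by auto
    have d0: "(\<lambda>i. \<integral>x. \<bar>d i x\<bar> \<partial>M) \<longlonglongrightarrow> 0"
      unfolding d_def using lim by (intro M.integrable_L1_limit) auto
    have ps: "p = (\<lambda>x. s i x + d i x)" for i by (simp add: d_def)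
    \<comment> \<open>Both sides agree on \<open>s i\<close>, so the discrepancy at \<open>p\<close>
      equals that at the error \<open>d i\<close>. It is at most \<open>2 * C\<close> times the
      \<open>L^1\<close> norm of \<open>d i\<close>, which tends to 0.\<close>
    have eq: "(\<integral>x. h x * p x \<partial>M) - I p = (\<integral>x. h x * d i x \<partial>M) - I (d i)" for i
    proof -
      have "I p = I (s i) + I (d i)"
        by (subst ps[of i]) (simp only: I_def mean_partial_integral_add[OF F(1) lim(1) di])
      moreover have "(\<integral>x. h x * p x \<partial>M) = (\<integral>x. h x * s i x \<partial>M) + (\<integral>x. h x * d i x \<partial>M)"
        unfolding ps[of i] distrib_left
        by (intro Bochner_Integration.integral_add Linf_bounded_mult hL lim di)
      ultimately show ?thesis using lim.IH[of i] by simp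
    qed
    have "\<bar>(\<integral>x. h x * p x \<partial>M) - I p\<bar> \<le> 2 * C * (\<integral>x. \<bar>d i x\<bar> \<partial>M)" for i
    proof -
      have "\<bar>\<integral>x. h x * d i x \<partial>M\<bar> \<le> (\<integral>x. \<bar>h x * d i x\<bar> \<partial>M)" by (rule integral_abs_bound)
      also have "\<dots> \<le> (\<integral>x. C * \<bar>d i x\<bar> \<partial>M)"
      proof (rule integral_mono_AE)
        show "AE x in M. \<bar>h x * d i x\<bar> \<le> C * \<bar>d i x\<bar>"
          using hC by eventually_elim (auto simp: abs_mult h(2) intro!: mult_right_mono)
      qed (use di Linf_bounded_mult[OF hL di] in auto)
      finally have "\<bar>\<integral>x. h x * d i x \<partial>M\<bar> \<le> C * (\<integral>x. \<bar>d i x\<bar> \<partial>M)" by simp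
      with C[OF di[of i]] show ?thesis unfolding eq[of i] by linarith
    qed
    moreover have "(\<lambda>i. 2 * C * (\<integral>x. \<bar>d i x\<bar> \<partial>M)) \<longlonglongrightarrow> 0"
      using tendsto_mult_left[OF d0, of "2 * C"] by simp
    ultimately have "\<bar>(\<integral>x. h x * p x \<partial>M) - I p\<bar> \<le> 0"
      by (intro LIMSEQ_le_const) auto
    then show ?case by simp
  qed
  then have "weak_mean M m F h" using hL by (simp add: weak_mean_def I_def)
  then show ?thesis by blast
qed

lemma weak_mean_add:
  assumes F: "F \<in> Linf (M \<Otimes>\<^sub>M N)" "F' \<in> Linf (M \<Otimes>\<^sub>M N)" and w: "weak_mean M m F \<psi>" "weak_mean M m F' \<psi>'"
  shows "weak_mean M m (\<lambda>z. F z + F' z) (\<lambda>x. \<psi> x + \<psi>' x)"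
  unfolding weak_mean_def
proof (intro conjI allI impI)
  have L: "\<psi> \<in> Linf M" "\<psi>' \<in> Linf M" using w by (auto simp: weak_mean_def)
  then show "(\<lambda>x. \<psi> x + \<psi>' x) \<in> Linf M" by (rule Linf_add)
  fix p :: "'a \<Rightarrow> real" assume p: "integrable M p"
  have "AE h in N. (\<integral>x. (F (x, h) + F' (x, h)) * p x \<partial>M) =
      (\<integral>x. F (x, h) * p x \<partial>M) + (\<integral>x. F' (x, h) * p x \<partial>M)"
    using AE_slice_integrable[OF F(1) p] AE_slice_integrable[OF F(2) p]
    by eventually_elim (simp add: distrib_right)
  then have "m (\<lambda>h. \<integral>x. (F (x, h) + F' (x, h)) * p x \<partial>M) =
      m (\<lambda>h. (\<integral>x. F (x, h) * p x \<partial>M) + (\<integral>x. F' (x, h) * p x \<partial>M))"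
    using partial_integral_Linf[OF Linf_add[OF F] p] F p
    by (intro mean_cong[OF m] Linf_add partial_integral_Linf) auto
  also have "\<dots> = m (\<lambda>h. \<integral>x. F (x, h) * p x \<partial>M) + m (\<lambda>h. \<integral>x. F' (x, h) * p x \<partial>M)"
    by (intro mean_add[OF m] partial_integral_Linf F p)
  also have "\<dots> = (\<integral>x. \<psi> x * p x \<partial>M) + (\<integral>x. \<psi>' x * p x \<partial>M)"
    using w p by (simp add: weak_mean_def)
  also have "\<dots> = (\<integral>x. (\<psi> x + \<psi>' x) * p x \<partial>M)"
    unfolding distrib_right by (intro Bochner_Integration.integral_add[symmetric] Linf_bounded_mult L p)
  finally show "(\<integral>x. (\<psi> x + \<psi>' x) * p x \<partial>M) = m (\<lambda>h. \<integral>x. (F (x, h) + F' (x, h)) * p x \<partial>M)" by simp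
qed

lemma weak_mean_scale:
  assumes F: "F \<in> Linf (M \<Otimes>\<^sub>M N)" and w: "weak_mean M m F \<psi>"
  shows "weak_mean M m (\<lambda>z. c * F z) (\<lambda>x. c * \<psi> x)"
  using w mean_scale[OF m partial_integral_Linf[OF F], of _ c]
  by (auto simp: weak_mean_def mult.assoc intro!: Linf_scale)

text \<open>The inner integral does not depend on \<open>h\<close>, and a mean sends a constant to
  its value.\<close>

lemma weak_mean_fst:
  assumes "f \<in> Linf M"
  shows "weak_mean M m (\<lambda>(x, h). f x) f"
  using assms by (simp add: weak_mean_def mean_const[OF m])

text \<open>A change of \<open>F\<close> on a null set alters, for almost every \<open>h\<close>,
  the slice only on a null set; \<open>m\<close> ignores the remaining \<open>h\<close>.\<close>

lemma weak_mean_cong: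
  assumes F: "F \<in> Linf (M \<Otimes>\<^sub>M N)" "F' \<in> Linf (M \<Otimes>\<^sub>M N)" and eq: "AE z in M \<Otimes>\<^sub>M N. F z = F' z"
    and w: "weak_mean M m F \<psi>"
  shows "weak_mean M m F' \<psi>"
  unfolding weak_mean_def
proof (intro conjI allI impI)
  show "\<psi> \<in> Linf M" using w by (simp add: weak_mean_def)
  fix p :: "'a \<Rightarrow> real" assume p: "integrable M p"
  have "AE h in N. (\<integral>x. F (x, h) * p x \<partial>M) = (\<integral>x. F' (x, h) * p x \<partial>M)"
    using MN.AE_pair_flipped[OF eq] AE_slice_integrable[OF F(1) p] AE_slice_integrable[OF F(2) p]
    by eventually_elim (auto intro!: integral_cong_AE elim!: eventually_mono)
  then have "m (\<lambda>h. \<integral>x. F (x, h) * p x \<partial>M) = m (\<lambda>h. \<integral>x. F' (x, h) * p x \<partial>M)"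
    by (intro mean_cong[OF m] partial_integral_Linf F p)
  then show "(\<integral>x. \<psi> x * p x \<partial>M) = m (\<lambda>h. \<integral>x. F' (x, h) * p x \<partial>M)"
    using w p by (simp add: weak_mean_def)
qed

text \<open>An essential bound \<open>C\<close> makes \<open>F z + C\<close> nonnegative; the
  constant is subtracted again by linearity.\<close>

lemma weak_mean_exists:
  assumes F: "F \<in> Linf (M \<Otimes>\<^sub>M N)"
  shows "\<exists>\<psi>. weak_mean M m F \<psi>"
proof -
  obtain C where C: "AE z in M \<Otimes>\<^sub>M N. \<bar>F z\<bar> \<le> C" using F by (auto simp: Linf_def)
  have F1: "(\<lambda>z. F z + C) \<in> Linf (M \<Otimes>\<^sub>M N)" by (intro Linf_add F Linf_const)
  have "AE z in M \<Otimes>\<^sub>M N. 0 \<le> F z + C" using C by eventually_elim linarith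
  from weak_mean_exists_nonneg[OF F1 this] obtain \<psi> where \<psi>: "weak_mean M m (\<lambda>z. F z + C) \<psi>" by blast
  have "weak_mean M m (\<lambda>(x, h). - C) (\<lambda>_. - C)" by (rule weak_mean_fst[OF Linf_const])
  then have c: "weak_mean M m (\<lambda>_. - C) (\<lambda>_. - C)" by (simp add: split_def)
  have "weak_mean M m (\<lambda>z. (F z + C) + - C) (\<lambda>x. \<psi> x + - C)"
    by (rule weak_mean_add[OF F1 Linf_const \<psi> c])
  then show ?thesis by (auto simp: add.assoc)
qed

end

text \<open>Composition with \<open>T\<close> is transposed to \<open>L^1\<close>: \<open>q\<close>
  is the density of the image under \<open>T\<close> of the signed measure with density
  \<open>p\<close>. With \<open>h\<close> the density of the image of \<open>M\<close>, it is
  \<open>q x = h x * p (T' x)\<close>.\<close>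

lemma pushforward_integral:
  assumes M: "finite_measure M" and T: "T \<in> M \<rightarrow>\<^sub>M M" "absolutely_continuous M (distr M M T)"
    and T': "T' \<in> M \<rightarrow>\<^sub>M M" "\<And>x. x \<in> space M \<Longrightarrow> T' (T x) = x" and p: "integrable M p"
  obtains q :: "'a \<Rightarrow> real" where "integrable M q"
    "\<And>k. k \<in> borel_measurable M \<Longrightarrow> (\<integral>x. k (T x) * p x \<partial>M) = (\<integral>x. k x * q x \<partial>M)"
proof -
  interpret finite_measure M by fact
  have "finite_measure (distr M M T)" by (rule finite_measure_distr[OF T(1)])
  then obtain h :: "'a \<Rightarrow> real" where hm[measurable]: "h \<in> borel_measurable M"
    and h: "\<And>x. 0 \<le> h x" "distr M M T = density M h"
    using real_density_exists[OF _ sets_distr T(2)] by blast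
  have pm: "p \<in> borel_measurable M" using p by auto
  have pT[measurable]: "(\<lambda>x. p (T' x)) \<in> borel_measurable M" by (rule measurable_compose[OF T'(1) pm])
  define q where "q x = h x * p (T' x)" for x
  have "integrable M (\<lambda>x. p (T' (T x)))"
    using p by (rule Bochner_Integration.integrable_cong[THEN iffD2, rotated 2]) (simp_all add: T')
  then have "integrable (distr M M T) (\<lambda>x. p (T' x))"
    using integrable_distr_eq[OF T(1) pT] by simp
  then have "integrable M q"
    unfolding h(2) q_def[abs_def] using integrable_density[OF pT hm] h(1) by simp
  moreover have "(\<integral>x. k (T x) * p x \<partial>M) = (\<integral>x. k x * q x \<partial>M)" if km[measurable]: "k \<in> borel_measurable M" for k
  proof -
    have kp: "(\<lambda>x. k x * p (T' x)) \<in> borel_measurable M" by measurable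
    have "(\<integral>x. k (T x) * p x \<partial>M) = (\<integral>x. k (T x) * p (T' (T x)) \<partial>M)"
      by (intro Bochner_Integration.integral_cong) (simp_all add: T')
    also have "\<dots> = (\<integral>x. k x * p (T' x) \<partial>distr M M T)"
      by (rule integral_distr[OF T(1) kp, symmetric])
    also have "\<dots> = (\<integral>x. k x * q x \<partial>M)"
      unfolding h(2) using integral_density[OF kp hm] h(1) by (simp add: q_def ac_simps)
    finally show ?thesis .
  qed
  ultimately show ?thesis by (rule that)
qed

lemma amenable_group_imp_zimmer_amenable:
  fixes haar :: "'g::topological_group_add measure" and M :: "'a measure"
  assumes M: "prob_space M" and haar: "sigma_finite_measure haar" "space haar = UNIV"
    and T: "\<And>g. T g \<in> M \<rightarrow>\<^sub>M M" "\<And>g. absolutely_continuous M (distr M M (T g))"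
    and T_inv: "\<And>g x. x \<in> space M \<Longrightarrow> T (- g) (T g x) = x"
    and am: "amenable_group haar"
  shows "zimmer_amenable haar M T"
proof -
  obtain m where m: "mean_on_Linf haar m" and minv: "\<And>g f. f \<in> Linf haar \<Longrightarrow> m (\<lambda>x. f (g + x)) = m f"
    using am by (auto simp: amenable_group_def)
  interpret mean_pair M haar m
    using M haar(1) m by (simp add: mean_pair_def mean_pair_axioms_def)
  \<comment> \<open>The choice is made separately for each \<open>F\<close>; uniqueness of weak
    means up to null sets makes the identities required of \<open>P\<close> hold almost
    everywhere.\<close>
  define P where "P F = (SOME \<psi>. weak_mean M m F \<psi>)" for F
  have P_some: "weak_mean M m F (P F)" if "weak_mean M m F \<psi>" for F \<psi>
    unfolding P_def by (rule someI[of "weak_mean M m F", OF that])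
  have P_eq: "AE x in M. P F x = \<psi> x" if "weak_mean M m F \<psi>" for F \<psi>
    by (rule weak_mean_unique[OF M.finite_measure_axioms P_some[OF that] that])
  have P: "weak_mean M m F (P F)" if "F \<in> Linf (M \<Otimes>\<^sub>M haar)" for F
    using weak_mean_exists[OF that] P_some by blast
  have "positive_unital_linear_map (M \<Otimes>\<^sub>M haar) M P"
    unfolding positive_unital_linear_map_def
  proof (intro conjI ballI allI impI)
    fix F assume F: "F \<in> Linf (M \<Otimes>\<^sub>M haar)"
    show "P F \<in> Linf M" using P[OF F] by (simp add: weak_mean_def)
    show "AE y in M. P (\<lambda>x. c * F x) y = c * P F y" for c
      by (rule P_eq[OF weak_mean_scale[OF F P[OF F]]])
    show "AE y in M. 0 \<le> P F y" if nn: "AE x in M \<Otimes>\<^sub>M haar. 0 \<le> F x"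
    proof (rule Linf_nonneg_if_integrals_nonneg[OF M.finite_measure_axioms])
      show "P F \<in> Linf M" using P[OF F] by (simp add: weak_mean_def)
      show "0 \<le> (\<integral>x. P F x * p x \<partial>M)" if "integrable M p" "\<And>x. 0 \<le> p x" for p
        using P[OF F] mean_partial_integral_nonneg[OF F nn that] that by (simp add: weak_mean_def)
    qed
    fix F' assume F': "F' \<in> Linf (M \<Otimes>\<^sub>M haar)"
    show "AE y in M. P F y = P F' y" if "AE x in M \<Otimes>\<^sub>M haar. F x = F' x"
    proof -
      have "AE y in M. P F' y = P F y" by (rule P_eq[OF weak_mean_cong[OF F F' that P[OF F]]])
      then show ?thesis by eventually_elim simp
    qed
    show "AE y in M. P (\<lambda>x. F x + F' x) y = P F y + P F' y"
      by (rule P_eq[OF weak_mean_add[OF F F' P[OF F] P[OF F']]])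
  next
    show "AE y in M. P (\<lambda>_. 1) y = 1"
      using P_eq[OF weak_mean_fst[OF Linf_const[of 1]]] by (simp add: split_def)
  qed
  moreover have "AE x in M. P (\<lambda>(x, h). f x) x = f x" if "f \<in> Linf M" for f
    by (rule P_eq[OF weak_mean_fst[OF that]])
  moreover have "AE x in M. P (\<lambda>(x, h). F (T g x, g + h)) x = P F (T g x)"
    if F: "F \<in> Linf (M \<Otimes>\<^sub>M haar)" for g F
  proof (rule P_eq)
    have PF: "P F \<in> Linf M" using P[OF F] by (simp add: weak_mean_def)
    have Fm: "F \<in> borel_measurable (M \<Otimes>\<^sub>M haar)" using F by (simp add: Linf_def)
    show "weak_mean M m (\<lambda>(x, h). F (T g x, g + h)) (\<lambda>x. P F (T g x))"
      unfolding weak_mean_def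
    proof (intro conjI allI impI)
      show "(\<lambda>x. P F (T g x)) \<in> Linf M" by (rule Linf_comp[OF PF T])
      fix p :: "'a \<Rightarrow> real" assume p: "integrable M p"
      obtain q where q: "integrable M q"
        "\<And>k. k \<in> borel_measurable M \<Longrightarrow> (\<integral>x. k (T g x) * p x \<partial>M) = (\<integral>x. k x * q x \<partial>M)"
        using pushforward_integral[OF M.finite_measure_axioms T(1,2) T(1) T_inv p] by metis
      \<comment> \<open>\<open>T g\<close> is moved from \<open>P F\<close> onto the test function,
        which becomes \<open>q\<close>; the duality defining \<open>P F\<close> and the invariance
        of \<open>m\<close> replace \<open>h\<close> by \<open>g + h\<close>; then the transposition
        is undone for each \<open>h\<close>.\<close>
      have "(\<integral>x. P F (T g x) * p x \<partial>M) = (\<integral>x. P F x * q x \<partial>M)"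
        using PF by (intro q(2)) (simp add: Linf_def)
      also have "\<dots> = m (\<lambda>h. \<integral>x. F (x, h) * q x \<partial>M)"
        using P[OF F] q(1) by (simp add: weak_mean_def)
      also have "\<dots> = m (\<lambda>h. \<integral>x. F (x, g + h) * q x \<partial>M)"
        using minv[OF partial_integral_Linf[OF F q(1)], of g] by simp
      also have "(\<lambda>h. \<integral>x. F (x, g + h) * q x \<partial>M) = (\<lambda>h. \<integral>x. F (T g x, g + h) * p x \<partial>M)"
      proof
        fix h
        have "(\<lambda>x. F (x, g + h)) \<in> borel_measurable M"
          by (rule measurable_Pair1[OF Fm]) (simp add: haar(2))
        then show "(\<integral>x. F (x, g + h) * q x \<partial>M) = (\<integral>x. F (T g x, g + h) * p x \<partial>M)"
          by (rule q(2)[symmetric])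
      qed
      finally show "(\<integral>x. P F (T g x) * p x \<partial>M) = m (\<lambda>h. \<integral>x. (case (x, h) of (x, h) \<Rightarrow> F (T g x, g + h)) * p x \<partial>M)"
        by simp
    qed
  qed
  ultimately show ?thesis unfolding zimmer_amenable_def by blast
qed

section \<open>Application to IDPFT systems\<close>

theorem proposition1p25:
  fixes \<nu> \<mu> :: "nat \<Rightarrow> 'z measure"
    and S :: "nat \<Rightarrow> 'g::{topological_group_add, second_countable_topology, t2_space} \<Rightarrow> 'z \<Rightarrow> 'z"
  assumes "locally_compact_space (euclidean :: 'g topology)"
    and "idpft \<nu> \<mu> S"
  shows "greenleaf_amenable (PiM UNIV \<mu>) (product_action S) \<and>
    (\<forall>haar :: 'g measure. left_haar_measure haar \<longrightarrow>
       (zimmer_amenable haar (PiM UNIV \<mu>) (product_action S) \<longleftrightarrow> amenable_group haar))"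
proof (intro conjI allI impI)
  let ?P = "PiM UNIV \<mu>" and ?T = "product_action S"
  have all: "prob_space (\<nu> n) \<and> measure_preserving_action (\<nu> n) (S n) \<and> prob_space (\<mu> n) \<and>
      equivalent_measures (\<mu> n) (\<nu> n)" for n
    using assms(2) unfolding idpft_def by blast
  then have \<nu>: "prob_space (\<nu> n)" and \<mu>: "prob_space (\<mu> n)" and s: "sets (\<nu> n) = sets (\<mu> n)"
    and ac: "absolutely_continuous (\<mu> n) (\<nu> n)" for n
    by (simp_all add: equivalent_measures_def)
  have pres: "distr (\<nu> n) (\<nu> n) (S n g) = \<nu> n" for n g
    using all[of n] by (simp add: measure_preserving_action_def)
  have action: "borel_action (\<nu> n) (S n)" for n
    using all[of n] by (simp add: measure_preserving_action_def)
  have S: "S n g \<in> \<nu> n \<rightarrow>\<^sub>M \<nu> n" for n g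
  proof -
    have "case_prod (S n) \<in> borel \<Otimes>\<^sub>M \<nu> n \<rightarrow>\<^sub>M \<nu> n" using action[of n] by (simp add: borel_action_def)
    from measurable_Pair2[OF this, of g] show ?thesis by simp
  qed
  have "S n g \<in> \<mu> n \<rightarrow>\<^sub>M \<mu> n" for n g using S by (simp only: measurable_cong_sets[OF s s])
  then have T: "?T g \<in> ?P \<rightarrow>\<^sub>M ?P" for g
    using measurable_PiM_componentwise[of "\<lambda>n. S n g" \<mu> \<mu>] by (simp add: product_action_def[abs_def])
  have ns: "absolutely_continuous ?P (distr ?P ?P (?T g))" for g
  proof -
    \<comment> \<open>In \<open>idpft\<close> the measure \<open>\<mu> \<circ> S(g)\<close> is the
      image under \<open>S(- g)\<close>, so the image under \<open>?T g\<close> is the instance at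
      \<open>- g\<close>.\<close>
    have "equivalent_measures (distr ?P ?P (?T (- (- g)))) ?P"
      using assms(2) unfolding idpft_def by blast
    then show ?thesis by (simp add: equivalent_measures_def)
  qed
  have T_inv: "?T (- g) (?T g z) = z" if z: "z \<in> space ?P" for g z
  proof
    fix n
    \<comment> \<open>The action laws are available on the carrier of \<open>\<nu> n\<close>, so
      membership is transferred from \<open>\<mu> n\<close>, which has the same sets.\<close>
    have "z n \<in> space (\<nu> n)" using z sets_eq_imp_space_eq[OF s] by (auto simp: space_PiM)
    moreover have "\<forall>x\<in>space (\<nu> n). S n 0 x = x" "\<forall>x\<in>space (\<nu> n). S n (- g + g) x = S n (- g) (S n g x)"
      using action[of n] unfolding borel_action_def by blast+
    ultimately show "?T (- g) (?T g z) n = z n" by (simp add: product_action_def)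
  qed
  show greenleaf: "greenleaf_amenable ?P ?T"
    by (rule greenleaf_amenable_product_action[OF \<mu> \<nu> s ac S pres ns])
  fix haar :: "'g measure" assume haar: "left_haar_measure haar"
  have P: "prob_space ?P" using \<mu> by (rule prob_space_PiM)
  have sf: "sigma_finite_measure haar" by (rule sigma_finite_left_haar_measure[OF assms(1) haar])
  have "space haar = UNIV"
    using haar sets_eq_imp_space_eq[of haar borel] by (simp add: left_haar_measure_def)
  then have "amenable_group haar \<Longrightarrow> zimmer_amenable haar ?P ?T"
    by (rule amenable_group_imp_zimmer_amenable[where T = ?T, OF P sf _ T ns T_inv])
  moreover have "zimmer_amenable haar ?P ?T \<Longrightarrow> amenable_group haar"
    by (rule zimmer_greenleaf_imp_amenable_group[where T = ?T, OF P sf T ns Linf_haar_translate[OF haar] greenleaf])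
  ultimately show "zimmer_amenable haar ?P ?T \<longleftrightarrow> amenable_group haar" by blast
qed

end
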